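(* Let $\mathcal{H}$ be a separable real Hilbert space, and let $A:\mathcal{H}\to 2^{\mathcal{H}}$, $B=\sum_{i=1}^N B_i:\mathcal{H}\to\mathcal{H}$ and $C:\mathcal{H}\to\mathcal{H}$ satisfy the following: (i) $A$ is maximally monotone; (ii) $B$ is monotone, each $B_i:\mathcal H\to\mathcal H$ is $L_i$-Lipschitz, and $B$ has a stochastic oracle $B_\xi$ (with $\xi\sim Q$) that is unbiased, $B(x)=\mathbb{E}[B_\xi(x)]$ for all $x\in\mathcal H$, and $L$-Lipschitz in mean with $L>0$, i.e. $\mathbb{E}[\|B_\xi(u)-B_\xi(v)\|^2]\le L^2\|u-v\|^2$ for all $u,v\in\mathcal{H}$; (iii) $C$ is $\beta$-cocoercive with $\beta>0$; (iv) the solution set $Z=\{x\in\mathcal H: 0\in (A+B+C)(x)\}$ is nonempty. Let $\lambda\in[0,1)$, $p\in(0,1]$ and $$\gamma\in\left(0,\ \frac{4\beta(1-\lambda)}{1+\sqrt{1+16\beta^2L^2(1-\lambda)}}\right).$$ Let $\{x^k\}_{k\in\mathbb N}$ and $\{w^k\}_{k\in\mathbb N}$ be generated by the algorithm VRFBHF (defined in the context) with parameters $p,Q,\gamma,\lambda$, and put $$\Phi_k(x)=\lambda\|x^k-x\|^2+\frac{1-\lambda}{p}\|w^k-x\|^2,\qquad x\in\mathcal H .$$ Then for every $x^*\in Z$ and every $k\in\mathbb N$, $$\mathbb{E}_k[\Phi_{k+1}(x^* )]\le \Phi_k(x^* )\quad\text{almost surely},$$ and the sequence $\{x^k\}_{k\in\mathbb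 N}$ converges weakly almost surely to a $Z$-valued random variable.
   Context: $\mathbb N$ is the set of nonnegative integers. An operator $T:\mathcal H\to\mathcal H$ is $\beta$-cocoercive if $\langle Tx-Ty,x-y\rangle\ge\beta\|Tx-Ty\|^2$ for all $x,y\in\mathcal H$. The resolvent of $A$ is $J_{\gamma A}=(\mathrm{Id}+\gamma A)^{-1}$, which is single-valued and everywhere defined for $A$ maximally monotone and $\gamma>0$. Stochastic oracle: $Q$ is a probability distribution on $\{1,\dots,N\}$, and for each value of $\xi\in\{1,\dots,N\}$ there is an operator $B_\xi:\mathcal H\to\mathcal H$; expectations $\mathbb E[B_\xi(x)]$ and $\mathbb{E}[\|B_\xi(u)-B_\xi(v)\|^2]$ are over $\xi\sim Q$. (Example: $Q(i)>0$ and $B_\xi=\frac{1}{Q(i)}B_i$ when $\xi=i$.) Algorithm VRFBHF. Input: $p\in(0,1]$, $Q$, step-size $\gamma$, $\lambda$; a (deterministic) starting point $x^0=w^0\in\mathcal H$. For $k=0,1,2,\dots$: 1. $\bar x^k=\lambda x^k+(1-\lambda)w^k$; 2. $y^k=J_{\gamma A}\big(\bar x^k-\gamma(B+C)w^k\big)$; 3. draw $\xi_k\sim Q$, independently of the past; 4. $x^{k+1}=y^k+\gamma(B_{\xi_k}w^k-B_{\xi_k}y^k)$; 5. $w^{k+1}=x^{k+1}$ with probability $p$, and $w^{k+1}=w^k$ with probability $1-p$ (this choice being made independently of $\xi_k$ and of the past). All random variables live on a probability space $(\Omega,\mathcal F,P)$; an $\mathcal H$-valued random variable is a measurable map into $\mathcal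 H$ with its Borel $\sigma$-algebra. $\mathbb E_k[\cdot]=\mathbb E[\,\cdot\mid\sigma(\xi_0,\dots,\xi_{k-1},w^0,\dots,w^k)]$ denotes conditional expectation given the history up to the start of iteration $k$. "$\{x^k\}$ converges weakly almost surely to a $Z$-valued random variable" means: there is a random variable $x^\infty$ with values in $Z$ such that, for $P$-almost every $\theta\in\Omega$, $x^k(\theta)\rightharpoonup x^\infty(\theta)$ weakly in $\mathcal H$. *)

theory Defs
  imports "HOL-Probability.Probability"
begin

definition monotone_operator :: "('a::real_inner \<Rightarrow> 'a set) \<Rightarrow> bool" where
  "monotone_operator T \<longleftrightarrow>
     (\<forall>x y. \<forall>u\<in>T x. \<forall>v\<in>T y. inner (u - v) (x - y) \<ge> 0)"

definition maximally_monotone :: "('a::real_inner \<Rightarrow> 'a set) \<Rightarrow> bool" where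
  "maximally_monotone T \<longleftrightarrow> monotone_operator T \<and>
     (\<forall>T'. monotone_operator T' \<and> (\<forall>x. T x \<subseteq> T' x) \<longrightarrow> T' = T)"

definition cocoercive :: "real \<Rightarrow> ('a::real_inner \<Rightarrow> 'a) \<Rightarrow> bool" where
  "cocoercive \<beta> T \<longleftrightarrow>
     (\<forall>x y. inner (T x - T y) (x - y) \<ge> \<beta> * (norm (T x - T y))\<^sup>2)"

definition scale_operator :: "real \<Rightarrow> ('a::real_vector \<Rightarrow> 'a set) \<Rightarrow> 'a \<Rightarrow> 'a set" where
  "scale_operator \<gamma> T x = (\<lambda>u. \<gamma> *\<^sub>R u) ` T x"

text \<open>The resolvent of \<open>T\<close> is \<open>(Id + T)\<inverse>\<close>; the description operator is meaningful because
  this inverse is single-valued and everywhere defined when \<open>T\<close> is maximally monotone.\<close>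

definition resolvent :: "('a::real_vector \<Rightarrow> 'a set) \<Rightarrow> 'a \<Rightarrow> 'a" where
  "resolvent T z = (THE y. z \<in> (\<lambda>u. y + u) ` T y)"

definition zeros3 :: "('a::real_vector \<Rightarrow> 'a set) \<Rightarrow> ('a \<Rightarrow> 'a) \<Rightarrow> ('a \<Rightarrow> 'a) \<Rightarrow> 'a set" where
  "zeros3 A B C = {x. 0 \<in> (\<lambda>u. u + B x + C x) ` A x}"

definition weakly_converges :: "(nat \<Rightarrow> 'a::real_inner) \<Rightarrow> 'a \<Rightarrow> bool" where
  "weakly_converges u l \<longleftrightarrow> (\<forall>z. (\<lambda>n. inner (u n) z) \<longlonglongrightarrow> inner l z)"

text \<open>The sigma-algebra generated by a random variable \<open>X\<close> with values in \<open>N\<close> is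
  \<open>vimage_algebra (space M) X N\<close>.\<close>

text \<open>The conditioning sigma-algebra of iteration \<open>k\<close>, generated by
  \<open>\<xi> 0, \<dots>, \<xi> (k - 1), w 0, \<dots>, w k\<close>.\<close>

definition history ::
  "'w measure \<Rightarrow> (nat \<Rightarrow> 'w \<Rightarrow> nat) \<Rightarrow> (nat \<Rightarrow> 'w \<Rightarrow> 'a::topological_space) \<Rightarrow> nat \<Rightarrow> 'w measure"
where
  "history M \<xi> w k = sigma (space M)
     ((\<Union>j\<in>{..<k}. sets (vimage_algebra (space M) (\<xi> j) (count_space UNIV))) \<union>
      (\<Union>j\<in>{..k}. sets (vimage_algebra (space M) (w j) borel)))"

text \<open>Everything that is known before the draws of iteration \<open>k\<close>: all earlier draws
  (including the update choices) and all iterates so far.\<close>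

definition past ::
  "'w measure \<Rightarrow> (nat \<Rightarrow> 'w \<Rightarrow> nat) \<Rightarrow> (nat \<Rightarrow> 'w \<Rightarrow> bool) \<Rightarrow>
   (nat \<Rightarrow> 'w \<Rightarrow> 'a::topological_space) \<Rightarrow> (nat \<Rightarrow> 'w \<Rightarrow> 'a) \<Rightarrow> nat \<Rightarrow> 'w measure"
where
  "past M \<xi> coin x w k = sigma (space M)
     ((\<Union>j\<in>{..<k}. sets (vimage_algebra (space M) (\<xi> j) (count_space UNIV))) \<union>
      (\<Union>j\<in>{..<k}. sets (vimage_algebra (space M) (coin j) (count_space UNIV))) \<union>
      (\<Union>j\<in>{..k}. sets (vimage_algebra (space M) (x j) borel)) \<union>
      (\<Union>j\<in>{..k}. sets (vimage_algebra (space M) (w j) borel)))"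

text \<open>A run of the algorithm on the probability space \<open>M\<close>. \<open>Bo i\<close> is the oracle operator for
  the value \<open>i\<close>, and \<open>coin k\<close> is the random choice whether \<open>w\<close> is updated. Measurability of
  \<open>x\<close> and \<open>w\<close> is required because \<open>Bo i\<close> is arbitrary for values \<open>i\<close> of probability zero.\<close>

locale VRFBHF = prob_space M
  for M :: "'w measure" +
  fixes A :: "'a::{real_inner,banach,second_countable_topology} \<Rightarrow> 'a set"
    and B C :: "'a \<Rightarrow> 'a"
    and N :: nat
    and Q :: "nat pmf"
    and Bo :: "nat \<Rightarrow> 'a \<Rightarrow> 'a"
    and p \<gamma> lam :: real
    and x0 :: 'a
    and \<xi> :: "nat \<Rightarrow> 'w \<Rightarrow> nat"
    and coin :: "nat \<Rightarrow> 'w \<Rightarrow> bool"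
    and x w y :: "nat \<Rightarrow> 'w \<Rightarrow> 'a"
  assumes x_rv: "x k \<in> borel_measurable M"
    and w_rv: "w k \<in> borel_measurable M"
    and xi_rv: "\<xi> k \<in> measurable M (count_space {1..N})"
    and coin_rv: "coin k \<in> measurable M (count_space UNIV)"
    and x_0: "\<omega> \<in> space M \<Longrightarrow> x 0 \<omega> = x0"
    and w_0: "\<omega> \<in> space M \<Longrightarrow> w 0 \<omega> = x0"
    and y_step: "\<omega> \<in> space M \<Longrightarrow>
      y k \<omega> = resolvent (scale_operator \<gamma> A)
        ((lam *\<^sub>R x k \<omega> + (1 - lam) *\<^sub>R w k \<omega>) - \<gamma> *\<^sub>R (B (w k \<omega>) + C (w k \<omega>)))"
    and xi_distr: "distr M (count_space UNIV) (\<xi> k) = measure_pmf Q"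
    and xi_indep: "indep_set
      (sets (vimage_algebra (space M) (\<xi> k) (count_space UNIV)))
      (sets (past M \<xi> coin x w k))"
    and x_step: "\<omega> \<in> space M \<Longrightarrow>
      x (Suc k) \<omega> = y k \<omega> + \<gamma> *\<^sub>R (Bo (\<xi> k \<omega>) (w k \<omega>) - Bo (\<xi> k \<omega>) (y k \<omega>))"
    and coin_distr: "distr M (count_space UNIV) (coin k) = measure_pmf (bernoulli_pmf p)"
    and coin_indep: "indep_set
      (sets (vimage_algebra (space M) (coin k) (count_space UNIV)))
      (sigma_sets (space M)
        (sets (past M \<xi> coin x w k) \<union>
         sets (vimage_algebra (space M) (\<xi> k) (count_space UNIV))))"
    and w_step: "\<omega> \<in> space M \<Longrightarrow>
      w (Suc k) \<omega> = (if coin k \<omega> then x (Suc k) \<omega> else w k \<omega>)"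

definition Phi :: "real \<Rightarrow> real \<Rightarrow> 'a::real_normed_vector \<Rightarrow> 'a \<Rightarrow> 'a \<Rightarrow> real" where
  "Phi lam p xk wk z = lam * (norm (xk - z))\<^sup>2 + (1 - lam) / p * (norm (wk - z))\<^sup>2"

end

theory Submission
  imports Defs
begin

text \<open>
  Put \<open>T = A + B + C\<close>, so that the solutions are the zeros of \<open>T\<close>. Given the current pair
  \<open>(x, w)\<close>, let \<open>y\<close> be the result of the resolvent step. Expanding the square in
  \<open>E \<parallel>y + \<gamma>(B\<^sub>\<xi> w - B\<^sub>\<xi> y) - z\<parallel>\<^sup>2\<close> for a solution \<open>z\<close>, the mean of the correction is
  \<open>\<gamma>(B w - B y)\<close> because the oracle is unbiased, and its second moment is at most
  \<open>\<gamma>\<^sup>2 L\<^sup>2 \<parallel>w - y\<parallel>\<^sup>2\<close>. Monotonicity of \<open>A\<close> and \<open>B\<close> and cocoercivity of \<open>C\<close> then give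
  (lemma \<open>descent\<close>)
  \<open>E \<parallel>x\<^sup>+ - z\<parallel>\<^sup>2 \<le> \<lambda> \<parallel>x - z\<parallel>\<^sup>2 + (1 - \<lambda>) \<parallel>w - z\<parallel>\<^sup>2 - \<epsilon> \<parallel>w - y\<parallel>\<^sup>2\<close> with
  \<open>\<epsilon> = 1 - \<lambda> - \<gamma>/(2\<beta>) - \<gamma>\<^sup>2 L\<^sup>2\<close>, and the bound on \<open>\<gamma>\<close> is exactly \<open>\<epsilon> > 0\<close>. Averaging over the coin
  as well, the weight \<open>(1 - \<lambda>)/p\<close> in \<open>\<Phi>\<close> makes the two sides match, and
  \<open>\<Phi>\<^sub>k(z)\<close> decreases in conditional mean by at least \<open>\<epsilon> \<parallel>w\<^sub>k - y\<^sub>k\<parallel>\<^sup>2\<close>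
  (lemma \<open>expected_descent\<close>). This is the first claim.

  Hence \<open>\<Phi>\<^sub>k(z)\<close> plus the accumulated decrease is a nonnegative supermartingale, and Doob's upcrossing
  argument makes it converge almost surely: \<open>\<Phi>\<^sub>k(z)\<close> converges and
  \<open>\<Sum>\<^sub>k \<parallel>w\<^sub>k - y\<^sub>k\<parallel>\<^sup>2\<close> is finite. The exceptional null set depends on \<open>z\<close>, so this is used for
  a countable dense set of solutions only. Every oracle value of positive probability is Lipschitz,
  so \<open>x\<^sub>k\<close>, \<open>w\<^sub>k\<close> and \<open>y\<^sub>k\<close> are asymptotically equal on almost every path. It follows that
  \<open>\<parallel>y\<^sub>k - z\<parallel>\<close> converges, first on the dense set and then for every solution, and that \<open>T y\<^sub>k\<close>
  contains elements tending to \<open>0\<close>.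

  These two properties imply weak convergence of \<open>y\<^sub>k\<close> to a zero of \<open>T\<close>
  (lemma \<open>weakly_converges_to_zero_of_operator\<close>). Weak compactness is avoided: in its place stands
  the asymptotic centre of the sequence, the minimiser of \<open>v \<mapsto> limsup \<parallel>y\<^sub>k - v\<parallel>\<^sup>2\<close>, which the
  nonexpansive resolvent of \<open>T\<close> has to fix. That \<open>T\<close> and \<open>\<gamma>A\<close> have everywhere defined resolvents is
  Minty's theorem, obtained by minimising the Fitzpatrick function plus half the squared norm. Both
  minimisations are instances of lemma \<open>epigraph_minimiser\<close>.
\<close>

section \<open>Minimising a strongly convex function\<close>

text \<open>The parallelogram law for \<open>\<parallel>z\<parallel>\<^sup>2\<close> makes every minimising sequence of \<open>t + \<parallel>z\<parallel>\<^sup>2 / 2\<close> a Cauchy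
  sequence, so completeness alone yields a minimiser. Comparing it with the points of the segment to
  \<open>(z, t)\<close> gives the subgradient inequality. The function enters through a set of pairs \<open>(z, t)\<close>, to be
  thought of as its epigraph, because the two functions of interest take the value \<open>+\<infinity>\<close> or are only
  given as an upper limit.\<close>

lemma epigraph_minimiser:
  fixes E :: "('b::{real_inner,banach} \<times> real) set"
  assumes "closed E" "convex E" "E \<noteq> {}"
    and nonneg: "\<And>z t. (z, t) \<in> E \<Longrightarrow> 0 \<le> t + (norm z)\<^sup>2 / 2"
  obtains z0 t0 where "(z0, t0) \<in> E" "\<And>z t. (z, t) \<in> E \<Longrightarrow> t0 + inner z0 (z0 - z) \<le> t"
proof -
  define val where "val = (\<lambda>e::'b \<times> real. snd e + (norm (fst e))\<^sup>2 / 2)"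
  define m where "m = Inf (val ` E)"
  have bdd: "bdd_below (val ` E)"
    using nonneg by (intro bdd_belowI[of _ 0]) (auto simp: val_def)
  have m_le: "m \<le> val e" if "e \<in> E" for e
    unfolding m_def using bdd that by (intro cInf_lower) auto
  have "\<exists>e\<in>E. val e < m + inverse (real (Suc n))" for n
  proof -
    have "\<exists>v\<in>val ` E. v < m + inverse (real (Suc n))"
      using \<open>E \<noteq> {}\<close> bdd unfolding m_def
      by (subst cInf_less_iff[symmetric]) (auto intro: positive_imp_inverse_positive)
    then show ?thesis by blast
  qed
  then obtain s where sE: "\<And>n. s n \<in> E" and s_val: "\<And>n. val (s n) < m + inverse (real (Suc n))"
    by metis
  define zs ts where "zs n = fst (s n)" and "ts n = snd (s n)" for n
  have gap: "(norm (zs i - zs j))\<^sup>2 \<le> 4 * (inverse (real (Suc i)) + inverse (real (Suc j)))" for i j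
  proof -
    \<comment> \<open>The midpoint cannot beat the infimum; this is what forces the two terms together.\<close>
    have "(1/2) *\<^sub>R s i + (1/2) *\<^sub>R s j \<in> E"
      using \<open>convex E\<close> sE[of i] sE[of j] by (auto simp: convex_def)
    from m_le[OF this]
    have "m \<le> (ts i + ts j) / 2 + (norm ((1/2) *\<^sub>R zs i + (1/2) *\<^sub>R zs j))\<^sup>2 / 2"
      by (simp add: val_def zs_def ts_def add_divide_distrib)
    moreover have "(norm ((1/2) *\<^sub>R zs i + (1/2) *\<^sub>R zs j))\<^sup>2
        = ((norm (zs i))\<^sup>2 + (norm (zs j))\<^sup>2) / 2 - (norm (zs i - zs j))\<^sup>2 / 4"
      by (simp add: power2_norm_eq_inner inner_add inner_diff inner_commute field_simps)
    moreover have "ts n + (norm (zs n))\<^sup>2 / 2 < m + inverse (real (Suc n))" for n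
      using s_val[of n] by (simp add: val_def zs_def ts_def)
    note this[of i] this[of j]
    ultimately show ?thesis by argo
  qed
  have "Cauchy zs"
  proof (rule metric_CauchyI)
    fix e :: real assume "e > 0"
    then obtain n0 where n0: "inverse (real (Suc n0)) < e\<^sup>2 / 8"
      using reals_Archimedean[of "e\<^sup>2 / 8"] by auto
    have "dist (zs i) (zs j) < e" if "i \<ge> n0" "j \<ge> n0" for i j
    proof -
      have "inverse (real (Suc i)) \<le> inverse (real (Suc n0))" "inverse (real (Suc j)) \<le> inverse (real (Suc n0))"
        using that by (simp_all add: le_imp_inverse_le)
      with gap[of i j] n0 have "(norm (zs i - zs j))\<^sup>2 < e\<^sup>2" by argo
      then show ?thesis using \<open>e > 0\<close> by (simp add: dist_norm power_less_imp_less_base)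
    qed
    then show "\<exists>M. \<forall>m\<ge>M. \<forall>n\<ge>M. dist (zs m) (zs n) < e" by blast
  qed
  then obtain z0 where z0: "zs \<longlonglongrightarrow> z0"
    using Cauchy_convergent convergent_def by blast
  define t0 where "t0 = m - (norm z0)\<^sup>2 / 2"
  have "(\<lambda>n. val (s n)) \<longlonglongrightarrow> m"
  proof (rule tendsto_sandwich)
    show "\<forall>\<^sub>F n in sequentially. m \<le> val (s n)" using m_le sE by simp
    show "\<forall>\<^sub>F n in sequentially. val (s n) \<le> m + inverse (real (Suc n))"
      by (intro always_eventually allI less_imp_le s_val)
    show "(\<lambda>n. m + inverse (real (Suc n))) \<longlonglongrightarrow> m"
      using tendsto_add[OF tendsto_const LIMSEQ_inverse_real_of_nat, of m] by simp
  qed simp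
  then have "(\<lambda>n. val (s n) - (norm (zs n))\<^sup>2 / 2) \<longlonglongrightarrow> t0"
    unfolding t0_def by (intro tendsto_intros z0) auto
  then have "ts \<longlonglongrightarrow> t0" by (simp add: val_def zs_def ts_def[abs_def])
  with z0 have "s \<longlonglongrightarrow> (z0, t0)"
    using tendsto_Pair[of zs z0 sequentially ts t0] by (simp add: zs_def ts_def)
  with \<open>closed E\<close> sE have in_E: "(z0, t0) \<in> E" by (metis closed_sequentially)
  moreover have "t0 + inner z0 (z0 - z) \<le> t" if zt: "(z, t) \<in> E" for z t
  proof -
    \<comment> \<open>Minimality along the segment from \<open>(z0, t0)\<close> to \<open>(z, t)\<close>, divided by the step \<open>r\<close>; then \<open>r \<rightarrow> 0\<close>.\<close>
    define a where "a = t - t0 - inner z0 (z0 - z)"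
    have ineq: "0 \<le> a + r * ((norm (z - z0))\<^sup>2 / 2)" if "0 < r" "r \<le> 1" for r :: real
    proof -
      have "(1 - r) *\<^sub>R (z0, t0) + r *\<^sub>R (z, t) \<in> E"
        using \<open>convex E\<close> in_E zt that by (auto simp: convex_alt simp del: scaleR_Pair)
      from m_le[OF this]
      have "m \<le> (1 - r) * t0 + r * t + (norm ((1 - r) *\<^sub>R z0 + r *\<^sub>R z))\<^sup>2 / 2"
        by (simp add: val_def)
      moreover have "(1 - r) *\<^sub>R z0 + r *\<^sub>R z = z0 + r *\<^sub>R (z - z0)"
        by (simp add: algebra_simps)
      moreover have "(norm (z0 + r *\<^sub>R (z - z0)))\<^sup>2
          = (norm z0)\<^sup>2 - 2 * r * inner z0 (z0 - z) + r\<^sup>2 * (norm (z - z0))\<^sup>2"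
        unfolding power2_norm_eq_inner
        by (simp add: inner_add inner_diff inner_commute algebra_simps power2_eq_square)
      ultimately have "0 \<le> r * (a + r * ((norm (z - z0))\<^sup>2 / 2))"
        unfolding a_def t0_def by (simp add: algebra_simps power2_eq_square) argo
      then show ?thesis using \<open>0 < r\<close> by (simp add: zero_le_mult_iff)
    qed
    have "((\<lambda>r. a + r * ((norm (z - z0))\<^sup>2 / 2)) \<longlongrightarrow> a + 0 * ((norm (z - z0))\<^sup>2 / 2)) (at_right (0::real))"
      by (intro tendsto_intros)
    moreover have "\<forall>\<^sub>F r in at_right (0::real). 0 \<le> a + r * ((norm (z - z0))\<^sup>2 / 2)"
      using ineq by (auto simp: eventually_at_right_field intro!: exI[of _ 1])
    ultimately have "0 \<le> a + 0 * ((norm (z - z0))\<^sup>2 / 2)"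
      by (intro tendsto_lowerbound) auto
    then show ?thesis by (simp add: a_def)
  qed
  ultimately show ?thesis using that by blast
qed

section \<open>Maximally monotone operators and their resolvents\<close>

text \<open>Maximality only needs to be tested by adjoining a single pair to the graph, a form that no longer
  quantifies over operators.\<close>

lemma maximally_monotone_iff:
  "maximally_monotone T \<longleftrightarrow> monotone_operator T \<and>
     (\<forall>x u. (\<forall>y. \<forall>v\<in>T y. 0 \<le> inner (u - v) (x - y)) \<longrightarrow> u \<in> T x)"
proof (intro iffI conjI allI impI)
  assume max: "maximally_monotone T"
  then show mono: "monotone_operator T" by (simp add: maximally_monotone_def)
  fix x u assume rel: "\<forall>y. \<forall>v\<in>T y. 0 \<le> inner (u - v) (x - y)"
  have rel': "0 \<le> inner (v - u) (y - x)" if "v \<in> T y" for y v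
    using rel that by (metis inner_minus_left inner_minus_right minus_diff_eq minus_minus)
  have "monotone_operator (T(x := insert u (T x)))"
    using mono rel rel' unfolding monotone_operator_def by (auto split: if_splits)
  with max have "T(x := insert u (T x)) = T"
    unfolding maximally_monotone_def by auto
  then show "u \<in> T x" by (metis fun_upd_same insertI1)
next
  assume *: "monotone_operator T \<and>
     (\<forall>x u. (\<forall>y. \<forall>v\<in>T y. 0 \<le> inner (u - v) (x - y)) \<longrightarrow> u \<in> T x)"
  show "maximally_monotone T"
    unfolding maximally_monotone_def
  proof (intro conjI allI impI ext)
    fix T' x assume T': "monotone_operator T' \<and> (\<forall>x. T x \<subseteq> T' x)"
    then have "T' x \<subseteq> T x" using * unfolding monotone_operator_def by blast
    with T' show "T' x = T x" by blast
  qed (use * in blast)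
qed

lemma maximally_monotone_affine:
  assumes T: "maximally_monotone T" and "c > 0"
  shows "maximally_monotone (\<lambda>x. (\<lambda>u. c *\<^sub>R u - z) ` T x)"
  unfolding maximally_monotone_iff
proof (intro conjI allI impI)
  have "0 \<le> inner ((c *\<^sub>R u - z) - (c *\<^sub>R v - z)) (x - y)" if "u \<in> T x" "v \<in> T y" for x y u v
  proof -
    have "0 \<le> c * inner (u - v) (x - y)"
      using T that \<open>c > 0\<close> by (simp add: maximally_monotone_def monotone_operator_def)
    then show ?thesis by (simp add: inner_diff algebra_simps)
  qed
  then show "monotone_operator (\<lambda>x. (\<lambda>u. c *\<^sub>R u - z) ` T x)"
    unfolding monotone_operator_def by blast
  fix x u assume rel: "\<forall>y. \<forall>v\<in>(\<lambda>u. c *\<^sub>R u - z) ` T y. 0 \<le> inner (u - v) (x - y)"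
  have "inverse c *\<^sub>R (u + z) \<in> T x"
  proof -
    have "0 \<le> inner (inverse c *\<^sub>R (u + z) - v) (x - y)" if "v \<in> T y" for y v
    proof -
      have "0 \<le> inner (u - (c *\<^sub>R v - z)) (x - y)" using rel that by blast
      also have "u - (c *\<^sub>R v - z) = c *\<^sub>R (inverse c *\<^sub>R (u + z) - v)"
        using \<open>c > 0\<close> by (simp add: algebra_simps)
      finally show ?thesis using \<open>c > 0\<close> by (simp add: zero_le_mult_iff)
    qed
    then show ?thesis using T unfolding maximally_monotone_iff by blast
  qed
  moreover have "u = c *\<^sub>R (inverse c *\<^sub>R (u + z)) - z" using \<open>c > 0\<close> by simp
  ultimately show "u \<in> (\<lambda>u. c *\<^sub>R u - z) ` T x" by blast
qed

lemma maximally_monotone_scale: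
  "maximally_monotone T \<Longrightarrow> c > 0 \<Longrightarrow> maximally_monotone (scale_operator c T)"
  using maximally_monotone_affine[of T c 0] by (simp add: scale_operator_def[abs_def])

text \<open>Minty's theorem. The set \<open>E\<close> is the epigraph of the Fitzpatrick function
  \<open>F(x, u) = sup {\<langle>x, v\<rangle> + \<langle>y, u\<rangle> - \<langle>y, v\<rangle> | v \<in> T y}\<close>, which dominates \<open>\<langle>x, u\<rangle>\<close> by maximality and agrees
  with it on the graph. At the minimiser \<open>(x, u)\<close> of \<open>F + \<parallel>\<cdot>\<parallel>\<^sup>2 / 2\<close>, the subgradient inequality tested
  on the graph reads \<open>\<parallel>x + u\<parallel>\<^sup>2 \<le> \<langle>- x - v, - u - y\<rangle>\<close>. Hence \<open>(- u, - x)\<close> belongs to the graph, and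
  testing with this very pair gives \<open>x + u = 0\<close>.\<close>

lemma minty_zero:
  fixes T :: "'a::{real_inner,banach} \<Rightarrow> 'a set"
  assumes T: "maximally_monotone T"
  shows "\<exists>x. - x \<in> T x"
proof -
  have related: "u \<in> T x" if "\<And>y v. v \<in> T y \<Longrightarrow> 0 \<le> inner (u - v) (x - y)" for x u
    using T that unfolding maximally_monotone_iff by blast
  have mono: "0 \<le> inner (u - v) (x - y)" if "u \<in> T x" "v \<in> T y" for x y u v
    using T that unfolding maximally_monotone_def monotone_operator_def by blast
  define E where "E = {((x, u), t). \<forall>y. \<forall>v\<in>T y. inner x v + inner y u - inner y v \<le> t}"
  have E_alt: "E = (\<Inter>(y, v)\<in>{(y, v). v \<in> T y}.
      {e. inner (fst (fst e)) v + inner y (snd (fst e)) - inner y v \<le> snd e})"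
    by (auto simp: E_def)
  have "closed E"
    unfolding E_alt by (auto intro!: closed_INT closed_Collect_le continuous_intros)
  have "convex E"
    unfolding convex_def
  proof (intro ballI allI impI)
    fix e f :: "('a \<times> 'a) \<times> real" and a b :: real
    assume ef: "e \<in> E" "f \<in> E" and ab: "0 \<le> a" "0 \<le> b" "a + b = 1"
    obtain x u t where e: "e = ((x, u), t)" by (metis prod.exhaust)
    obtain x' u' t' where f: "f = ((x', u'), t')" by (metis prod.exhaust)
    have "inner (a *\<^sub>R x + b *\<^sub>R x') v + inner y (a *\<^sub>R u + b *\<^sub>R u') - inner y v \<le> a * t + b * t'"
      if v: "v \<in> T y" for y v
    proof -
      have "inner x v + inner y u - inner y v \<le> t" "inner x' v + inner y u' - inner y v \<le> t'"
        using ef v by (auto simp: E_def e f)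
      then have "a * (inner x v + inner y u - inner y v) + b * (inner x' v + inner y u' - inner y v)
          \<le> a * t + b * t'"
        using ab by (intro add_mono mult_left_mono) auto
      moreover have "a * inner y v + b * inner y v = inner y v"
        using ab by (metis distrib_right mult_1)
      ultimately show ?thesis by (simp add: inner_add algebra_simps)
    qed
    then show "a *\<^sub>R e + b *\<^sub>R f \<in> E" by (simp add: E_def e f)
  qed
  have graph: "((x, u), inner x u) \<in> E" if "u \<in> T x" for x u
    unfolding E_def using mono[OF that] by (force simp: inner_diff inner_commute algebra_simps)
  have fitzpatrick: "inner x u \<le> t" if e: "((x, u), t) \<in> E" for x u t
  proof (rule ccontr)
    assume "\<not> inner x u \<le> t"
    then have *: "inner (u - v) (x - y) > 0" if "v \<in> T y" for y v
      using e that by (force simp: E_def inner_diff inner_commute algebra_simps)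
    then have "u \<in> T x" using related by (meson less_imp_le)
    from *[OF this] show False by simp
  qed
  have sq: "(norm (x + u))\<^sup>2 = (norm (x, u))\<^sup>2 + 2 * inner x u" for x u :: 'a
    by (simp add: norm_Pair power2_norm_eq_inner inner_add inner_commute)
  have "E \<noteq> {}"
  proof -
    have "\<exists>x u. u \<in> T x" using related[of 0 0] by blast
    then show ?thesis using graph by blast
  qed
  moreover have "0 \<le> t + (norm z)\<^sup>2 / 2" if "(z, t) \<in> E" for z t
  proof -
    obtain x u where z: "z = (x, u)" by (metis prod.exhaust)
    show ?thesis using fitzpatrick that sq[of x u] zero_le_power2[of "norm (x + u)"] unfolding z by force
  qed
  ultimately obtain z0 t0 where min_in: "(z0, t0) \<in> E"
      and min: "\<And>z t. (z, t) \<in> E \<Longrightarrow> t0 + inner z0 (z0 - z) \<le> t"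
    using epigraph_minimiser[OF \<open>closed E\<close> \<open>convex E\<close>] by metis
  obtain x u where z0: "z0 = (x, u)" by (metis prod.exhaust)
  have key: "(norm (x + u))\<^sup>2 \<le> inner (- x - v) (- u - y)" if "v \<in> T y" for y v
  proof -
    have "t0 + inner z0 (z0 - (y, v)) \<le> inner y v" using min graph that by blast
    moreover have "inner x u \<le> t0" using fitzpatrick min_in z0 by blast
    ultimately show ?thesis
      by (simp add: z0 power2_norm_eq_inner inner_add inner_diff inner_commute algebra_simps)
  qed
  have "- x \<in> T (- u)"
  proof (rule related)
    fix y v assume "v \<in> T y"
    from key[OF this] show "0 \<le> inner (- x - v) (- u - y)"
      using zero_le_power2 order_trans by blast
  qed
  with key have "(norm (x + u))\<^sup>2 \<le> 0" by fastforce
  then have "- u = x" by (simp add: add.commute minus_unique)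
  with \<open>- x \<in> T (- u)\<close> show ?thesis by auto
qed

lemma minty:
  fixes T :: "'a::{real_inner,banach} \<Rightarrow> 'a set"
  assumes "maximally_monotone T"
  shows "\<exists>x. z - x \<in> T x"
proof -
  obtain x where "- x \<in> (\<lambda>u. u - z) ` T x"
    using minty_zero[OF maximally_monotone_affine[OF assms zero_less_one, of z]] by auto
  then show ?thesis by (auto simp: algebra_simps intro!: exI[of _ x])
qed

lemma monotone_resolvent_nonexpansive:
  assumes "monotone_operator T" "a - x \<in> T x" "b - y \<in> T y"
  shows "norm (x - y) \<le> norm (a - b)"
proof -
  have "0 \<le> inner ((a - x) - (b - y)) (x - y)"
    using assms unfolding monotone_operator_def by blast
  then have "(norm (x - y))\<^sup>2 \<le> inner (a - b) (x - y)"
    by (simp add: power2_norm_eq_inner inner_diff algebra_simps)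
  also have "\<dots> \<le> norm (a - b) * norm (x - y)" by (rule norm_cauchy_schwarz)
  finally show ?thesis
    by (cases "norm (x - y) = 0") (auto simp: power2_eq_square)
qed

lemma resolvent_eq_iff:
  fixes T :: "'a::{real_inner,banach} \<Rightarrow> 'a set"
  assumes T: "maximally_monotone T"
  shows "resolvent T z = x \<longleftrightarrow> z - x \<in> T x"
proof -
  have mem: "z \<in> (\<lambda>u. y + u) ` T y \<longleftrightarrow> z - y \<in> T y" for y
    by (auto simp: image_iff algebra_simps intro!: bexI[of _ "z - y"])
  have uniq: "y = y'" if "z - y \<in> T y" "z - y' \<in> T y'" for y y'
    using monotone_resolvent_nonexpansive[OF _ that] T by (simp add: maximally_monotone_def)
  then have "\<exists>!y. z - y \<in> T y" using minty[OF T, of z] by (metis (no_types))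
  then have "z - resolvent T z \<in> T (resolvent T z)"
    unfolding resolvent_def mem by (rule theI')
  then show ?thesis using uniq by blast
qed

lemma resolvent_nonexpansive:
  fixes T :: "'a::{real_inner,banach} \<Rightarrow> 'a set"
  assumes T: "maximally_monotone T"
  shows "norm (resolvent T a - resolvent T b) \<le> norm (a - b)"
  using monotone_resolvent_nonexpansive resolvent_eq_iff[OF T] T maximally_monotone_def by metis

text \<open>Let \<open>(x, u)\<close> be monotonically related to the graph of \<open>T + F\<close>. For small \<open>c\<close> the inclusion
  \<open>x + c u \<in> y + c (T y + F y)\<close> has a solution \<open>y\<close>, being a fixed point problem for a contraction built
  from the resolvent of \<open>c T\<close>. Relatedness to this point of the graph says \<open>0 \<le> - \<parallel>x - y\<parallel>\<^sup>2\<close>, whence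
  \<open>y = x\<close>.\<close>

lemma maximally_monotone_add_Lipschitz:
  fixes T :: "'a::{real_inner,banach} \<Rightarrow> 'a set"
  assumes T: "maximally_monotone T"
    and F: "\<And>x y. 0 \<le> inner (F x - F y) (x - y)" and lip: "K-lipschitz_on UNIV F"
  shows "maximally_monotone (\<lambda>x. (\<lambda>u. u + F x) ` T x)"
  unfolding maximally_monotone_iff
proof (intro conjI allI impI)
  have "0 \<le> inner (u + F x - (v + F y)) (x - y)" if "u \<in> T x" "v \<in> T y" for x y u v
  proof -
    have "0 \<le> inner (u - v) (x - y)"
      using T that unfolding maximally_monotone_def monotone_operator_def by blast
    then show ?thesis using F[of x y] by (simp add: inner_diff inner_add algebra_simps)
  qed
  then show "monotone_operator (\<lambda>x. (\<lambda>u. u + F x) ` T x)"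
    unfolding monotone_operator_def by blast
  fix x u assume rel: "\<forall>y. \<forall>v\<in>(\<lambda>u. u + F y) ` T y. 0 \<le> inner (u - v) (x - y)"
  have "0 \<le> K" using lip lipschitz_on_nonneg by blast
  \<comment> \<open>Any \<open>c > 0\<close> with \<open>c K < 1\<close> would do.\<close>
  define c where "c = 1 / (K + 1)"
  have c: "0 < c" "c * K < 1" "0 \<le> c * K" using \<open>0 \<le> K\<close> by (simp_all add: c_def)
  define G where "G y = resolvent (scale_operator c T) (x + c *\<^sub>R u - c *\<^sub>R F y)" for y
  have cT: "maximally_monotone (scale_operator c T)"
    using maximally_monotone_scale[OF T c(1)] .
  have "dist (G y) (G y') \<le> (c * K) * dist y y'" for y y'
  proof -
    have "norm (G y - G y') \<le> norm ((x + c *\<^sub>R u - c *\<^sub>R F y) - (x + c *\<^sub>R u - c *\<^sub>R F y'))"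
      unfolding G_def by (rule resolvent_nonexpansive[OF cT])
    also have "\<dots> = c * norm (F y - F y')"
      using c by (simp flip: scaleR_diff_right add: norm_minus_commute)
    also have "\<dots> \<le> c * (K * norm (y - y'))"
      using c lip by (auto simp: lipschitz_on_def dist_norm intro!: mult_left_mono)
    finally show ?thesis by (simp add: dist_norm mult.assoc)
  qed
  then obtain y where "G y = y"
    using banach_fix_type[of "c * K" G] c by auto
  then have "(x + c *\<^sub>R u - c *\<^sub>R F y) - y \<in> scale_operator c T y"
    using resolvent_eq_iff[OF cT] G_def by metis
  then obtain v where v: "v \<in> T y" "x - y = c *\<^sub>R (v + F y - u)"
    by (auto simp: scale_operator_def algebra_simps)
  have "0 \<le> inner (u - (v + F y)) (x - y)" using rel v by blast
  then have "0 \<le> c * inner (u - (v + F y)) (x - y)" using c by simp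
  also have "\<dots> = - inner (x - y) (x - y)"
  proof -
    have "c *\<^sub>R (u - (v + F y)) = - (x - y)" unfolding v(2) by (simp add: algebra_simps)
    then show ?thesis by (metis inner_minus_left inner_scaleR_left)
  qed
  finally have "x = y"
    by (metis add.inverse_neutral inner_eq_zero_iff inner_ge_zero neg_le_0_iff_le order_antisym right_minus_eq neg_0_le_iff_le)
  with v c have "u = v + F x" by auto
  with v \<open>x = y\<close> show "u \<in> (\<lambda>u. u + F x) ` T x" by blast
qed

section \<open>Asymptotic centres and weak convergence\<close>

text \<open>This says \<open>limsup \<parallel>u k - z\<parallel>\<^sup>2 \<le> r\<close> along the filter \<open>G\<close>. A filter in place of a subsequence lets one
  notion cover the whole sequence and the indices selected by a property that holds infinitely
  often.\<close>

definition asymptotic_bound :: "'k filter \<Rightarrow> ('k \<Rightarrow> 'a::real_normed_vector) \<Rightarrow> 'a \<Rightarrow> real \<Rightarrow> bool" where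
  "asymptotic_bound G u z r \<longleftrightarrow> (\<forall>e>0. \<forall>\<^sub>F k in G. (norm (u k - z))\<^sup>2 \<le> r + e)"

lemma asymptotic_bound_ge_limit:
  assumes "((\<lambda>k. (norm (u k - z))\<^sup>2) \<longlongrightarrow> l) G" "G \<noteq> bot" "asymptotic_bound G u z r"
  shows "l \<le> r"
proof (rule field_le_epsilon)
  fix e :: real assume "e > 0"
  then show "l \<le> r + e"
    using assms by (intro tendsto_upperbound[OF assms(1)]) (auto simp: asymptotic_bound_def)
qed

lemma asymptotic_bound_limit:
  assumes "((\<lambda>k. (norm (u k - z))\<^sup>2) \<longlongrightarrow> l) G"
  shows "asymptotic_bound G u z l"
  unfolding asymptotic_bound_def
proof (intro allI impI)
  fix e :: real assume "e > 0"
  then have "\<forall>\<^sub>F k in G. (norm (u k - z))\<^sup>2 < l + e"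
    by (intro order_tendstoD(2)[OF assms]) auto
  then show "\<forall>\<^sub>F k in G. (norm (u k - z))\<^sup>2 \<le> l + e"
    by (rule eventually_mono) simp
qed

text \<open>Splitting \<open>\<parallel>z\<parallel>\<^sup>2 / 2\<close> off from \<open>limsup \<parallel>u k - z\<parallel>\<^sup>2 / 2\<close> leaves the upper limit of the functions \<open>q k\<close>,
  which are affine in \<open>z\<close> and equicontinuous. Its epigraph is thus closed and convex, and a minimiser
  exists. The subgradient inequality at the minimiser \<open>c\<close> turns into growth of the upper limit by at
  least \<open>\<parallel>z - c\<parallel>\<^sup>2\<close>; in particular \<open>c\<close> is the only minimiser.\<close>

lemma asymptotic_centre:
  fixes u :: "'k \<Rightarrow> 'a::{real_inner,banach}"
  assumes "G \<noteq> bot" and bdd: "\<And>k. norm (u k) \<le> K"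
  obtains c r0 where "asymptotic_bound G u c r0"
    "\<And>z r. asymptotic_bound G u z r \<Longrightarrow> r0 + (norm (z - c))\<^sup>2 \<le> r"
proof -
  define q where "q k z = (norm (u k))\<^sup>2 / 2 - inner (u k) z" for k z
  have q_sq: "q k z = ((norm (u k - z))\<^sup>2 - (norm z)\<^sup>2) / 2" for k z
    unfolding q_def by (simp add: power2_norm_eq_inner inner_diff inner_commute field_simps)
  define E where "E = {(z, t). \<forall>e>0. \<forall>\<^sub>F k in G. q k z \<le> t + e}"
  have bound_E: "asymptotic_bound G u z r \<longleftrightarrow> (z, (r - (norm z)\<^sup>2) / 2) \<in> E" for z r
  proof -
    have "q k z \<le> (r - (norm z)\<^sup>2) / 2 + e \<longleftrightarrow> (norm (u k - z))\<^sup>2 \<le> r + 2 * e" for k e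
      unfolding q_sq by argo
    then have "(z, (r - (norm z)\<^sup>2) / 2) \<in> E \<longleftrightarrow>
        (\<forall>e>0. \<forall>\<^sub>F k in G. (norm (u k - z))\<^sup>2 \<le> r + 2 * e)"
      by (simp add: E_def)
    also have "\<dots> \<longleftrightarrow> asymptotic_bound G u z r"
    proof (intro iffI)
      assume *: "\<forall>e>0. \<forall>\<^sub>F k in G. (norm (u k - z))\<^sup>2 \<le> r + 2 * e"
      show "asymptotic_bound G u z r"
        unfolding asymptotic_bound_def using *[rule_format, of "e / 2" for e] by simp
    qed (simp add: asymptotic_bound_def)
    finally show ?thesis by simp
  qed
  have "K \<ge> 0" using bdd norm_ge_zero order_trans by blast
  have "closed E"
    unfolding closed_sequential_limits
  proof (intro allI impI, elim conjE)
    fix s l assume s: "\<forall>n. s n \<in> E" "s \<longlonglongrightarrow> l"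
    obtain z t where l: "l = (z, t)" by (metis prod.exhaust)
    have lim: "(\<lambda>n. K * norm (fst (s n) - z) + (snd (s n) - t)) \<longlonglongrightarrow> K * norm (fst l - z) + (snd l - t)"
      by (intro tendsto_intros s)
    have "\<forall>\<^sub>F k in G. q k z \<le> t + e" if "e > 0" for e
    proof -
      have "\<forall>\<^sub>F n in sequentially. K * norm (fst (s n) - z) + (snd (s n) - t) < e / 2"
        using \<open>e > 0\<close> l by (intro order_tendstoD(2)[OF lim]) auto
      then obtain n where n: "K * norm (fst (s n) - z) + (snd (s n) - t) < e / 2"
        using eventually_happens[of _ sequentially] by auto
      have "\<forall>\<^sub>F k in G. q k (fst (s n)) \<le> snd (s n) + e / 2"
        using s(1)[rule_format, of n] \<open>e > 0\<close> by (auto simp: E_def case_prod_beta)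
      then show ?thesis
      proof (rule eventually_mono)
        fix k assume k: "q k (fst (s n)) \<le> snd (s n) + e / 2"
        have "q k z = q k (fst (s n)) + inner (u k) (fst (s n) - z)"
          by (simp add: q_def inner_diff)
        also have "inner (u k) (fst (s n) - z) \<le> norm (u k) * norm (fst (s n) - z)"
          by (rule norm_cauchy_schwarz)
        also have "\<dots> \<le> K * norm (fst (s n) - z)"
          by (intro mult_right_mono bdd) auto
        finally have "q k z \<le> q k (fst (s n)) + K * norm (fst (s n) - z)" by simp
        then show "q k z \<le> t + e" using k n by argo
      qed
    qed
    then show "l \<in> E" by (simp add: E_def l)
  qed
  moreover have "convex E"
    unfolding convex_def
  proof (intro ballI allI impI)
    fix x y :: "'a \<times> real" and a b :: real
    assume xy: "x \<in> E" "y \<in> E" and ab: "0 \<le> a" "0 \<le> b" "a + b = 1"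
    have "\<forall>\<^sub>F k in G. q k (a *\<^sub>R fst x + b *\<^sub>R fst y) \<le> a * snd x + b * snd y + e" if "e > 0" for e
    proof -
      have "\<forall>\<^sub>F k in G. q k (fst x) \<le> snd x + e \<and> q k (fst y) \<le> snd y + e"
        using xy \<open>e > 0\<close> by (auto simp: E_def case_prod_beta intro: eventually_conj)
      then show ?thesis
      proof (rule eventually_mono, elim conjE)
        fix k assume k: "q k (fst x) \<le> snd x + e" "q k (fst y) \<le> snd y + e"
        have b: "b = 1 - a" using ab by simp
        have "q k (a *\<^sub>R fst x + b *\<^sub>R fst y) = a * q k (fst x) + b * q k (fst y)"
          unfolding q_def b by (simp add: inner_add algebra_simps diff_divide_distrib add_divide_distrib)
        also have "\<dots> \<le> a * (snd x + e) + b * (snd y + e)"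
          by (intro add_mono mult_left_mono k ab)
        also have "\<dots> = a * snd x + b * snd y + e"
          unfolding b by (simp add: algebra_simps)
        finally show "q k (a *\<^sub>R fst x + b *\<^sub>R fst y) \<le> a * snd x + b * snd y + e" .
      qed
    qed
    then show "a *\<^sub>R x + b *\<^sub>R y \<in> E" by (simp add: E_def case_prod_beta)
  qed
  moreover have "(0, K\<^sup>2 / 2) \<in> E"
  proof -
    have "(norm (u k))\<^sup>2 \<le> K\<^sup>2" for k by (intro power_mono bdd) auto
    then have "asymptotic_bound G u 0 (K\<^sup>2)"
      by (auto simp: asymptotic_bound_def intro!: always_eventually intro: add_increasing2)
    then show ?thesis by (simp add: bound_E)
  qed
  moreover have "0 \<le> t + (norm z)\<^sup>2 / 2" if zt: "(z, t) \<in> E" for z t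
  proof (rule field_le_epsilon)
    fix e :: real assume "e > 0"
    then have "\<forall>\<^sub>F k in G. q k z \<le> t + e" using zt by (simp add: E_def)
    then obtain k where "q k z \<le> t + e"
      using \<open>G \<noteq> bot\<close> eventually_happens' by blast
    then show "0 \<le> t + (norm z)\<^sup>2 / 2 + e"
      using zero_le_power2[of "norm (u k - z)"] unfolding q_sq by argo
  qed
  ultimately obtain c t0 where c: "(c, t0) \<in> E"
      and min: "\<And>z t. (z, t) \<in> E \<Longrightarrow> t0 + inner c (c - z) \<le> t"
    using epigraph_minimiser[of E] by (metis empty_iff)
  show ?thesis
  proof (rule that[of c "2 * t0 + (norm c)\<^sup>2"])
    show "asymptotic_bound G u c (2 * t0 + (norm c)\<^sup>2)" using c by (simp add: bound_E)
    fix z r assume "asymptotic_bound G u z r"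
    then have "t0 + inner c (c - z) \<le> (r - (norm z)\<^sup>2) / 2" using min bound_E by blast
    moreover have "(norm (z - c))\<^sup>2 = (norm z)\<^sup>2 - (norm c)\<^sup>2 + 2 * inner c (c - z)"
      by (simp add: power2_norm_eq_inner inner_diff inner_commute)
    ultimately show "2 * t0 + (norm c)\<^sup>2 + (norm (z - c))\<^sup>2 \<le> r" by argo
  qed
qed

text \<open>An Opial type argument without weak compactness. Since \<open>u k\<close> is the resolvent of \<open>u k + v k\<close>, the
  resolvent of an asymptotic centre is again an asymptotic centre, so every centre is a fixed point of
  the resolvent and thus a zero of \<open>T\<close>. As \<open>\<parallel>u k - z\<parallel>\<close> has a limit for every zero \<open>z\<close>, the sequence and
  all its subsequences compare zeros in the same way and share one centre \<open>c\<close>. If \<open>\<langle>u k - c, h\<rangle> \<ge> e\<close> held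
  infinitely often, then \<open>c + h\<close> would do better along these \<open>k\<close> than the growth around the centre
  permits.\<close>

lemma weakly_converges_to_zero_of_operator:
  fixes T :: "'a::{real_inner,banach} \<Rightarrow> 'a set"
  assumes T: "maximally_monotone T"
    and graph: "\<And>k. v k \<in> T (u k)" and v: "v \<longlonglongrightarrow> 0"
    and fejer: "\<And>z. 0 \<in> T z \<Longrightarrow> convergent (\<lambda>k. norm (u k - z))"
    and zero: "0 \<in> T z0"
  obtains c where "0 \<in> T c" "weakly_converges u c"
proof -
  obtain K0 where K0: "\<And>k. norm (u k - z0) \<le> K0"
    using convergent_imp_Bseq[OF fejer[OF zero]] by (auto simp: Bseq_def)
  define K where "K = K0 + norm z0"
  have K: "norm (u k) \<le> K" for k
    using K0[of k] norm_triangle_ineq[of "u k - z0" z0] by (simp add: K_def)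
  define l where "l z = (lim (\<lambda>k. norm (u k - z)))\<^sup>2" for z
  have l: "((\<lambda>k. (norm (u k - z))\<^sup>2) \<longlongrightarrow> l z) G" if "0 \<in> T z" "G \<le> sequentially" for z G
    unfolding l_def using fejer[OF that(1)] that(2)
    by (intro tendsto_power) (auto simp: convergent_LIMSEQ_iff intro: tendsto_mono)
  have centre_zero: "0 \<in> T c"
    if G: "G \<le> sequentially"
      and c: "asymptotic_bound G u c r0"
      and min: "\<And>z r. asymptotic_bound G u z r \<Longrightarrow> r0 + (norm (z - c))\<^sup>2 \<le> r" for G c r0
  proof -
    \<comment> \<open>The price for replacing \<open>u k + v k\<close> by \<open>u k\<close> in a squared distance to \<open>c\<close>.\<close>
    define s where "s k = 2 * (K + norm c) * norm (v k) + (norm (v k))\<^sup>2" for k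
    have "s \<longlonglongrightarrow> 2 * (K + norm c) * norm (0::'a) + (norm (0::'a))\<^sup>2"
      unfolding s_def by (intro tendsto_intros v)
    then have s: "(s \<longlongrightarrow> 0) G" using G by (auto intro: tendsto_mono)
    have step: "(norm (u k - resolvent T c))\<^sup>2 \<le> (norm (u k - c))\<^sup>2 + s k" for k
    proof -
      have "u k = resolvent T (u k + v k)"
        using resolvent_eq_iff[OF T, of "u k + v k" "u k"] graph[of k] by simp
      then have "norm (u k - resolvent T c) \<le> norm (u k + v k - c)"
        using resolvent_nonexpansive[OF T, of "u k + v k" c] by simp
      also have "\<dots> \<le> norm (u k - c) + norm (v k)"
        using norm_triangle_ineq[of "u k - c" "v k"] by (simp add: algebra_simps)
      finally have "(norm (u k - resolvent T c))\<^sup>2 \<le> (norm (u k - c) + norm (v k))\<^sup>2"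
        by (intro power_mono) auto
      also have "\<dots> = (norm (u k - c))\<^sup>2 + 2 * norm (u k - c) * norm (v k) + (norm (v k))\<^sup>2"
        by (simp add: power2_sum)
      also have "2 * norm (u k - c) * norm (v k) \<le> 2 * (K + norm c) * norm (v k)"
        using norm_triangle_ineq4[of "u k" c] K[of k] by (intro mult_right_mono) auto
      finally show ?thesis by (simp add: s_def algebra_simps)
    qed
    have "asymptotic_bound G u (resolvent T c) r0"
      unfolding asymptotic_bound_def
    proof (intro allI impI)
      fix e :: real assume "e > 0"
      then have "\<forall>\<^sub>F k in G. (norm (u k - c))\<^sup>2 \<le> r0 + e / 2" "\<forall>\<^sub>F k in G. s k < e / 2"
        using c order_tendstoD(2)[OF s, of "e / 2"] by (auto simp: asymptotic_bound_def)
      then show "\<forall>\<^sub>F k in G. (norm (u k - resolvent T c))\<^sup>2 \<le> r0 + e"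
      proof eventually_elim
        case (elim k)
        then show ?case using step[of k] by argo
      qed
    qed
    from min[OF this] have "resolvent T c = c" by simp
    then show ?thesis using resolvent_eq_iff[OF T, of c c] by simp
  qed
  have bot: "sequentially \<noteq> bot" by simp
  obtain c r0 where c: "asymptotic_bound sequentially u c r0"
      and min: "\<And>z r. asymptotic_bound sequentially u z r \<Longrightarrow> r0 + (norm (z - c))\<^sup>2 \<le> r"
    by (rule asymptotic_centre[OF bot, of u K]) (use K in blast)+
  have Tc: "0 \<in> T c" using centre_zero[OF order_refl c min] by blast
  have half: "\<forall>\<^sub>F k in sequentially. inner (u k - c) h < e" if "e > 0" for h e
  proof (rule ccontr)
    assume not_ev: "\<not> ?thesis"
    \<comment> \<open>The limit along those indices at which the claimed inequality fails.\<close>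
    define G where "G = inf sequentially (principal {k. e \<le> inner (u k - c) h})"
    have G: "G \<le> sequentially" "G \<noteq> bot"
      using not_ev by (auto simp: G_def trivial_limit_def eventually_inf_principal not_le)
    obtain c' r' where c': "asymptotic_bound G u c' r'"
        and min': "\<And>z r. asymptotic_bound G u z r \<Longrightarrow> r' + (norm (z - c'))\<^sup>2 \<le> r"
      by (rule asymptotic_centre[OF G(2), of u K]) (use K in blast)+
    have Tc': "0 \<in> T c'" using centre_zero[OF G(1) c' min'] by blast
    have "r' + (norm (c - c'))\<^sup>2 \<le> l c"
      by (intro min' asymptotic_bound_limit l Tc G)
    moreover have "l c \<le> r0"
      by (rule asymptotic_bound_ge_limit[OF l[OF Tc order_refl] bot c])
    moreover have "r0 + (norm (c' - c))\<^sup>2 \<le> l c'"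
      by (intro min asymptotic_bound_limit l Tc' order_refl)
    moreover have l_r': "l c' \<le> r'"
      by (rule asymptotic_bound_ge_limit[OF l[OF Tc' G(1)] G(2) c'])
    moreover have "(norm (c - c'))\<^sup>2 = (norm (c' - c))\<^sup>2"
      by (simp add: norm_minus_commute)
    ultimately have "(norm (c - c'))\<^sup>2 \<le> 0" by argo
    then have "c' = c" by simp
    have "asymptotic_bound G u (c + h) (l c - 2 * e + (norm h)\<^sup>2)"
      unfolding asymptotic_bound_def
    proof (intro allI impI)
      fix d :: real assume "d > 0"
      then have "\<forall>\<^sub>F k in G. (norm (u k - c))\<^sup>2 \<le> l c + d"
        using asymptotic_bound_limit[OF l[OF Tc G(1)]] by (simp add: asymptotic_bound_def)
      moreover have "\<forall>\<^sub>F k in G. e \<le> inner (u k - c) h"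
        unfolding G_def eventually_inf_principal by simp
      ultimately show "\<forall>\<^sub>F k in G. (norm (u k - (c + h)))\<^sup>2 \<le> l c - 2 * e + (norm h)\<^sup>2 + d"
      proof eventually_elim
        case (elim k)
        have "(norm (u k - (c + h)))\<^sup>2 = (norm (u k - c))\<^sup>2 - 2 * inner (u k - c) h + (norm h)\<^sup>2"
          by (simp add: power2_norm_eq_inner inner_diff inner_add inner_commute)
        with elim show ?case by argo
      qed
    qed
    from min'[OF this] l_r' \<open>c' = c\<close> \<open>e > 0\<close> show False by simp
  qed
  have "weakly_converges u c"
    unfolding weakly_converges_def
  proof
    fix h
    show "(\<lambda>k. inner (u k) h) \<longlonglongrightarrow> inner c h"
    proof (rule tendstoI)
      fix e :: real assume "e > 0"
      from half[OF this, of h] half[OF this, of "- h"]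
      show "\<forall>\<^sub>F k in sequentially. dist (inner (u k) h) (inner c h) < e"
        by eventually_elim (simp add: dist_real_def inner_diff abs_less_iff)
    qed
  qed
  with Tc show ?thesis by (rule that)
qed

text \<open>The functions \<open>z \<mapsto> \<parallel>u k - z\<parallel>\<close> are uniformly Lipschitz, so convergence passes to the closure. This
  extends almost sure convergence from countably many solutions to all of them.\<close>

lemma convergent_norm_diff_closure:
  fixes u :: "nat \<Rightarrow> 'a::real_normed_vector"
  assumes conv: "\<And>z. z \<in> D \<Longrightarrow> convergent (\<lambda>k. norm (u k - z))" and "z \<in> closure D"
  shows "convergent (\<lambda>k. norm (u k - z))"
proof -
  have "Cauchy (\<lambda>k. norm (u k - z))"
  proof (rule metric_CauchyI)
    fix e :: real assume "e > 0"
    then obtain z' where z': "z' \<in> D" "dist z' z < e / 4"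
      using \<open>z \<in> closure D\<close> unfolding closure_approachable by (metis zero_less_divide_iff zero_less_numeral)
    obtain n where n: "\<And>i j. i \<ge> n \<Longrightarrow> j \<ge> n \<Longrightarrow> dist (norm (u i - z')) (norm (u j - z')) < e / 4"
      using metric_CauchyD[OF convergent_Cauchy[OF conv[OF z'(1)]], of "e / 4"] \<open>e > 0\<close> by auto
    have near: "\<bar>norm (u k - z) - norm (u k - z')\<bar> < e / 4" for k
      using norm_triangle_ineq3[of "u k - z" "u k - z'"] z'(2) by (simp add: dist_norm)
    have "dist (norm (u i - z)) (norm (u j - z)) < e" if "i \<ge> n" "j \<ge> n" for i j
      using n[OF that] near[of i] near[of j] unfolding dist_real_def by linarith
    then show "\<exists>n. \<forall>i\<ge>n. \<forall>j\<ge>n. dist (norm (u i - z)) (norm (u j - z)) < e" by blast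
  qed
  then show ?thesis by (rule Cauchy_convergent)
qed

section \<open>Convergence of nonnegative supermartingales\<close>

text \<open>The path is rising from the moment it falls below \<open>a\<close> until it next exceeds \<open>b\<close>. Whether it is
  rising at time \<open>k\<close> is decided by the values up to time \<open>k\<close>, so this flag is an admissible betting
  strategy.\<close>

primrec rising :: "real \<Rightarrow> real \<Rightarrow> (nat \<Rightarrow> real) \<Rightarrow> nat \<Rightarrow> bool" where
  "rising a b X 0 \<longleftrightarrow> X 0 < a"
| "rising a b X (Suc k) \<longleftrightarrow> (if rising a b X k then X (Suc k) \<le> b else X (Suc k) < a)"

definition upcrossing :: "real \<Rightarrow> real \<Rightarrow> (nat \<Rightarrow> real) \<Rightarrow> nat \<Rightarrow> bool" where
  "upcrossing a b X k \<longleftrightarrow> rising a b X k \<and> b < X (Suc k)"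

text \<open>Holding one unit while the path is rising earns at least \<open>b - a\<close> per completed upcrossing. The second
  summand on the left is the running loss of an uncompleted one, and including it makes the claim
  inductive.\<close>

lemma upcrossing_gain:
  assumes "a < b"
  shows "(b - a) * (\<Sum>k<n. of_bool (upcrossing a b X k)) + (if rising a b X n then X n - a else 0)
      \<le> (\<Sum>k<n. of_bool (rising a b X k) * (X (Suc k) - X k))"
proof (induction n)
  case 0
  then show ?case by simp
next
  case (Suc n)
  then show ?case using assms
    by (cases "rising a b X n"; cases "X (Suc n) \<le> b"; cases "X (Suc n) < a")
      (auto simp: upcrossing_def distrib_left)
qed

text \<open>Once there are no further upcrossings, a path that falls below \<open>a\<close> again stays in the rising phase for
  ever, hence never exceeds \<open>b\<close>.\<close>

lemma no_oscillation:
  assumes ev: "\<forall>\<^sub>F k in sequentially. \<not> upcrossing a b X k"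
    and below: "\<exists>\<^sub>F k in sequentially. X k < a"
  shows "\<forall>\<^sub>F k in sequentially. X k \<le> b"
proof -
  obtain n where n: "\<And>k. k \<ge> n \<Longrightarrow> \<not> upcrossing a b X k"
    using ev by (auto simp: eventually_sequentially)
  have "\<exists>m\<ge>n. rising a b X m"
  proof (rule ccontr)
    assume none: "\<not> (\<exists>m\<ge>n. rising a b X m)"
    obtain m where m: "Suc n \<le> m" "X m < a"
      using below by (auto simp: frequently_sequentially)
    then obtain j where j: "m = Suc j" "n \<le> j" using Suc_le_D[OF m(1)] by auto
    then have "rising a b X m" using none m by auto
    then show False using none m by auto
  qed
  then obtain m where m: "m \<ge> n" "rising a b X m" by blast
  have rising: "rising a b X k" if "k \<ge> m" for k
    using that
  proof (induction k rule: dec_induct)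
    case (step k)
    have "\<not> upcrossing a b X k" using n step m by simp
    then show ?case using step by (simp add: upcrossing_def)
  qed (rule m)
  have "X k \<le> b" if k: "k \<ge> Suc m" for k
  proof -
    obtain j where "k = Suc j" "j \<ge> m" using Suc_le_D[OF k] k by auto
    then show ?thesis using rising[of j] rising[of k] by simp
  qed
  then show ?thesis by (auto simp: eventually_sequentially)
qed

text \<open>If the lower limit were below the upper limit, then two rationals between them would be crossed
  infinitely often; the bound \<open>c\<close> excludes divergence to \<open>\<infinity>\<close>. Rational levels suffice, which matters
  because only countably many null sets can be discarded.\<close>

lemma convergent_if_no_oscillation:
  fixes X :: "nat \<Rightarrow> real"
  assumes nonneg: "\<And>k. 0 \<le> X k"
    and bdd: "\<exists>\<^sub>F k in sequentially. X k < c"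
    and osc: "\<And>a b :: rat. a < b \<Longrightarrow> \<exists>\<^sub>F k in sequentially. X k < real_of_rat a
        \<Longrightarrow> \<forall>\<^sub>F k in sequentially. X k \<le> real_of_rat b"
  shows "convergent X"
proof -
  have "convergent (\<lambda>k. ereal (X k))"
  proof (rule ccontr)
    assume "\<not> ?thesis"
    then have "liminf (\<lambda>k. ereal (X k)) < limsup (\<lambda>k. ereal (X k))"
      using Liminf_le_Limsup[of sequentially "\<lambda>k. ereal (X k)"]
      by (simp add: convergent_ereal order_less_le)
    then obtain b :: rat where b: "liminf (\<lambda>k. ereal (X k)) < real_of_rat b"
        "real_of_rat b < limsup (\<lambda>k. ereal (X k))"
      using ereal_dense3 by blast
    then obtain a :: rat where a: "liminf (\<lambda>k. ereal (X k)) < real_of_rat a"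
        "ereal (real_of_rat a) < real_of_rat b"
      using ereal_dense3 by blast
    have "\<exists>\<^sub>F k in sequentially. X k < real_of_rat a"
    proof (rule ccontr)
      assume "\<not> ?thesis"
      then have "\<forall>\<^sub>F k in sequentially. ereal (real_of_rat a) \<le> ereal (X k)"
        by (simp add: not_frequently not_less)
      from Liminf_bounded[OF this] a(1) show False by simp
    qed
    then have "\<forall>\<^sub>F k in sequentially. X k \<le> real_of_rat b"
      using osc a(2) by (simp add: of_rat_less)
    then have "limsup (\<lambda>k. ereal (X k)) \<le> real_of_rat b"
      by (intro Limsup_bounded) simp_all
    with b(2) show False by simp
  qed
  then obtain l where l: "(\<lambda>k. ereal (X k)) \<longlonglongrightarrow> l" by (auto simp: convergent_def)
  have "0 \<le> l" using l nonneg by (intro LIMSEQ_le_const[OF l]) auto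
  moreover have "l \<noteq> \<infinity>"
  proof
    assume "l = \<infinity>"
    then have "\<forall>\<^sub>F k in sequentially. ereal c < ereal (X k)"
      using order_tendstoD(1)[OF l, of "ereal c"] by simp
    with bdd have "\<exists>\<^sub>F k in sequentially. X k < c \<and> c < X k"
      by (intro frequently_eventually_frequently) auto
    then show False by (auto dest: frequently_ex)
  qed
  ultimately obtain r where "l = ereal r" by (cases l) auto
  with l show ?thesis by (auto simp: convergent_def)
qed

text \<open>Doob's convergence theorem. The expected gain of the betting strategy is nonpositive, so the expected
  number of upcrossings of \<open>[a, b]\<close> is at most \<open>\<bar>a\<bar> / (b - a)\<close>. By Borel-Cantelli almost surely
  only finitely many occur, and Fatou's lemma excludes divergence to \<open>\<infinity>\<close>. The supermartingale property
  is stated by integrals over events, the form in which it is verified below.\<close>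

lemma (in prob_space) supermartingale_convergent:
  fixes X :: "nat \<Rightarrow> 'a \<Rightarrow> real"
  assumes subalg: "\<And>k. subalgebra M (F k)" and mono: "\<And>k. sets (F k) \<subseteq> sets (F (Suc k))"
    and adapted: "\<And>k. X k \<in> borel_measurable (F k)"
    and int: "\<And>k. integrable M (X k)"
    and nonneg: "\<And>k \<omega>. \<omega> \<in> space M \<Longrightarrow> 0 \<le> X k \<omega>"
    and super: "\<And>k A. A \<in> sets (F k) \<Longrightarrow>
      (\<integral>\<omega>. indicator A \<omega> * X (Suc k) \<omega> \<partial>M) \<le> (\<integral>\<omega>. indicator A \<omega> * X k \<omega> \<partial>M)"
  shows "AE \<omega> in M. convergent (\<lambda>k. X k \<omega>)"
proof -
  have space_F: "space (F k) = space M" for k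
    using subalg by (simp add: subalgebra_def)
  have F_M: "sets (F k) \<subseteq> sets M" for k
    using subalg by (simp add: subalgebra_def)
  have mono_le: "sets (F j) \<subseteq> sets (F k)" if "j \<le> k" for j k
    using lift_Suc_mono_le[of "\<lambda>k. sets (F k)", OF mono that] .
  have X_meas: "X j \<in> borel_measurable (F k)" if "j \<le> k" for j k
    using measurable_from_subalg[of "F k" "F j", OF _ adapted] mono_le[OF that]
    by (simp add: subalgebra_def space_F)
  have rising_meas: "Measurable.pred (F k) (\<lambda>\<omega>. rising a b (\<lambda>j. X j \<omega>) k)" for k a b
  proof (induction k)
    case 0
    have [measurable]: "X 0 \<in> borel_measurable (F 0)" by (rule adapted)
    show ?case by simp
  next
    case (Suc k)
    have [measurable]: "X (Suc k) \<in> borel_measurable (F (Suc k))" by (rule adapted)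
    have [measurable]: "Measurable.pred (F (Suc k)) (\<lambda>\<omega>. rising a b (\<lambda>j. X j \<omega>) k)"
      using measurable_from_subalg[of "F (Suc k)" "F k", OF _ Suc] mono[of k]
      by (simp add: subalgebra_def space_F)
    show ?case by simp
  qed
  have X_M [measurable]: "X k \<in> borel_measurable M" for k
    using int by blast
  have rising_M [measurable]: "Measurable.pred M (\<lambda>\<omega>. rising a b (\<lambda>j. X j \<omega>) k)" for k a b
    by (rule measurable_from_subalg[OF subalg rising_meas])
  have rising_int: "integrable M (\<lambda>\<omega>. of_bool (rising a b (\<lambda>j. X j \<omega>) k) * Y \<omega>)"
    if Y: "integrable M Y" for a b k and Y :: "'a \<Rightarrow> real"
    by (rule Bochner_Integration.integrable_bound[OF Y]) (use Y in \<open>auto simp: of_bool_def\<close>)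
  have cross_AE: "AE \<omega> in M. \<forall>\<^sub>F k in sequentially. \<not> upcrossing a b (\<lambda>j. X j \<omega>) k"
    if "a < b" for a b
  proof -
    define U where "U k = {\<omega> \<in> space M. upcrossing a b (\<lambda>j. X j \<omega>) k}" for k
    have U [measurable]: "U k \<in> sets M" for k
      unfolding U_def upcrossing_def by measurable
    \<comment> \<open>The loss \<open>X n - a\<close> of an uncompleted upcrossing is at least \<open>- \<bar>a\<bar>\<close> because \<open>X n\<close> is nonnegative.\<close>
    have "(\<Sum>k<n. measure M (U k)) \<le> \<bar>a\<bar> / (b - a)" for n
    proof -
      define gain where "gain \<omega> = (\<Sum>k<n. of_bool (rising a b (\<lambda>j. X j \<omega>) k) * (X (Suc k) \<omega> - X k \<omega>))" for \<omega>
      have gain_int: "integrable M gain"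
        unfolding gain_def by (intro Bochner_Integration.integrable_sum rising_int Bochner_Integration.integrable_diff int)
      have "(\<integral>\<omega>. of_bool (rising a b (\<lambda>j. X j \<omega>) k) * (X (Suc k) \<omega> - X k \<omega>) \<partial>M) \<le> 0" for k
      proof -
        define A where "A = {\<omega> \<in> space M. rising a b (\<lambda>j. X j \<omega>) k}"
        have "A \<in> sets (F k)"
          using rising_meas[of a b k] by (simp add: A_def pred_def space_F)
        then have "(\<integral>\<omega>. indicator A \<omega> * X (Suc k) \<omega> \<partial>M) \<le> (\<integral>\<omega>. indicator A \<omega> * X k \<omega> \<partial>M)"
          by (rule super)
        moreover have "(\<integral>\<omega>. indicator A \<omega> * X j \<omega> \<partial>M)
            = (\<integral>\<omega>. of_bool (rising a b (\<lambda>j. X j \<omega>) k) * X j \<omega> \<partial>M)" for j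
          by (intro Bochner_Integration.integral_cong) (auto simp: A_def indicator_def)
        ultimately show ?thesis
          by (simp add: right_diff_distrib Bochner_Integration.integral_diff rising_int int)
      qed
      then have gain_le: "(\<integral>\<omega>. gain \<omega> \<partial>M) \<le> 0"
        unfolding gain_def
        by (subst Bochner_Integration.integral_sum)
          (auto intro!: sum_nonpos rising_int Bochner_Integration.integrable_diff int)
      have "(\<integral>\<omega>. (b - a) * (\<Sum>k<n. indicator (U k) \<omega>) \<partial>M) \<le> (\<integral>\<omega>. gain \<omega> + \<bar>a\<bar> \<partial>M)"
      proof (rule integral_mono)
        show "integrable M (\<lambda>\<omega>. (b - a) * (\<Sum>k<n. indicator (U k) \<omega> :: real))"
          by (intro integrable_mult_right Bochner_Integration.integrable_sum) (simp add: emeasure_finite less_top[symmetric] integrable_indicator_iff)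
        show "integrable M (\<lambda>\<omega>. gain \<omega> + \<bar>a\<bar>)" using gain_int by simp
        fix \<omega> assume \<omega>: "\<omega> \<in> space M"
        have "(\<Sum>k<n. indicator (U k) \<omega>) = (\<Sum>k<n. of_bool (upcrossing a b (\<lambda>j. X j \<omega>) k) :: real)"
          using \<omega> by (intro sum.cong) (auto simp: U_def indicator_def)
        then show "(b - a) * (\<Sum>k<n. indicator (U k) \<omega>) \<le> gain \<omega> + \<bar>a\<bar>"
          using upcrossing_gain[OF that, of "\<lambda>j. X j \<omega>" n] nonneg[OF \<omega>, of n]
          by (auto simp: gain_def split: if_splits)
      qed
      also have "\<dots> \<le> \<bar>a\<bar>" using gain_le gain_int by (simp add: prob_space)
      finally have "(b - a) * (\<Sum>k<n. measure M (U k)) \<le> \<bar>a\<bar>"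
        by (subst (asm) integral_mult_right_zero, subst (asm) Bochner_Integration.integral_sum)
          (auto simp: emeasure_finite less_top[symmetric] integrable_indicator_iff)
      then show ?thesis using that by (simp add: field_simps)
    qed
    then have "summable (\<lambda>k. measure M (U k))"
      by (intro summableI_nonneg_bounded) auto
    then have "AE \<omega> in M. \<forall>\<^sub>F k in sequentially. \<omega> \<in> space M - U k"
      by (intro borel_cantelli_AE1) (auto simp: emeasure_finite less_top[symmetric])
    then show ?thesis
      by (rule AE_mp, intro AE_I2) (auto simp: U_def elim!: eventually_mono)
  qed
  have cross_rat: "AE \<omega> in M. \<forall>a b :: rat. a < b \<longrightarrow>
      (\<forall>\<^sub>F k in sequentially. \<not> upcrossing (real_of_rat a) (real_of_rat b) (\<lambda>j. X j \<omega>) k)"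
    using cross_AE by (auto simp: AE_all_countable AE_impI of_rat_less)
  have E_le: "(\<integral>\<omega>. X k \<omega> \<partial>M) \<le> (\<integral>\<omega>. X 0 \<omega> \<partial>M)" for k
  proof (induction k)
    case (Suc k)
    have "space M \<in> sets (F k)" by (metis sets.top space_F)
    from super[OF this] Suc show ?case
      by (simp add: Bochner_Integration.integral_cong[of M M "\<lambda>\<omega>. indicator (space M) \<omega> * X j \<omega>" "X j" for j])
  qed simp
  have "(\<integral>\<^sup>+\<omega>. liminf (\<lambda>k. ennreal (X k \<omega>)) \<partial>M) \<le> liminf (\<lambda>k. \<integral>\<^sup>+\<omega>. ennreal (X k \<omega>) \<partial>M)"
    by (rule nn_integral_liminf) measurable
  also have "\<dots> \<le> ennreal (\<integral>\<omega>. X 0 \<omega> \<partial>M)"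
    using E_le by (intro Liminf_le)
      (auto simp: nn_integral_eq_integral[OF int AE_I2[OF nonneg]] intro!: always_eventually ennreal_leI)
  finally have "(\<integral>\<^sup>+\<omega>. liminf (\<lambda>k. ennreal (X k \<omega>)) \<partial>M) \<noteq> \<infinity>"
    by (auto simp: top_unique)
  then have "AE \<omega> in M. liminf (\<lambda>k. ennreal (X k \<omega>)) \<noteq> \<infinity>"
    by (intro nn_integral_PInf_AE) measurable
  with cross_rat AE_space show ?thesis
  proof eventually_elim
    case (elim \<omega>)
    obtain r where r: "liminf (\<lambda>k. ennreal (X k \<omega>)) = ennreal r" "r \<ge> 0"
      using elim(3) by (cases "liminf (\<lambda>k. ennreal (X k \<omega>))") auto
    have "\<exists>\<^sub>F k in sequentially. X k \<omega> < r + 1"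
    proof (rule ccontr)
      assume "\<not> ?thesis"
      then have "\<forall>\<^sub>F k in sequentially. ennreal (r + 1) \<le> ennreal (X k \<omega>)"
        by (auto simp: not_frequently not_less intro: ennreal_leI elim!: eventually_mono)
      from Liminf_bounded[OF this] r show False by (simp add: ennreal_le_iff2)
    qed
    with nonneg[OF elim(2)] show ?case
    proof (rule convergent_if_no_oscillation)
      fix a b :: rat assume "a < b" and below: "\<exists>\<^sub>F k in sequentially. X k \<omega> < real_of_rat a"
      with elim(1) have "\<forall>\<^sub>F k in sequentially. \<not> upcrossing (real_of_rat a) (real_of_rat b) (\<lambda>j. X j \<omega>) k"
        by blast
      from no_oscillation[OF this below]
      show "\<forall>\<^sub>F k in sequentially. X k \<omega> \<le> real_of_rat b" .
    qed
  qed
qed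

text \<open>A case of the Robbins-Siegmund theorem: adding the decreases accumulated so far to \<open>X\<close> gives a
  nonnegative supermartingale, whose convergence bounds the sum of the decreases.\<close>

lemma (in prob_space) almost_supermartingale_convergent:
  fixes X D :: "nat \<Rightarrow> 'a \<Rightarrow> real"
  assumes subalg: "\<And>k. subalgebra M (F k)" and mono: "\<And>k. sets (F k) \<subseteq> sets (F (Suc k))"
    and X_adapted: "\<And>k. X k \<in> borel_measurable (F k)" and D_adapted: "\<And>k. D k \<in> borel_measurable (F k)"
    and X_int: "\<And>k. integrable M (X k)" and D_int: "\<And>k. integrable M (D k)"
    and X_nonneg: "\<And>k \<omega>. \<omega> \<in> space M \<Longrightarrow> 0 \<le> X k \<omega>"
    and D_nonneg: "\<And>k \<omega>. \<omega> \<in> space M \<Longrightarrow> 0 \<le> D k \<omega>"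
    and super: "\<And>k A. A \<in> sets (F k) \<Longrightarrow>
      (\<integral>\<omega>. indicator A \<omega> * X (Suc k) \<omega> \<partial>M) \<le> (\<integral>\<omega>. indicator A \<omega> * (X k \<omega> - D k \<omega>) \<partial>M)"
  shows "AE \<omega> in M. convergent (\<lambda>k. X k \<omega>) \<and> summable (\<lambda>k. D k \<omega>)"
proof -
  define V where "V k \<omega> = X k \<omega> + (\<Sum>j<k. D j \<omega>)" for k \<omega>
  have space_F: "space (F k) = space M" for k
    using subalg by (simp add: subalgebra_def)
  have D_meas: "D j \<in> borel_measurable (F k)" if "j < k" for j k
    using measurable_from_subalg[of "F k" "F j", OF _ D_adapted]
      lift_Suc_mono_le[of "\<lambda>k. sets (F k)", OF mono, of j k] that
    by (simp add: subalgebra_def space_F)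
  have ind_int: "integrable M (\<lambda>\<omega>. indicator A \<omega> * Y \<omega>)" if "A \<in> sets (F k)" "integrable M Y"
    for A k and Y :: "'a \<Rightarrow> real"
    using integrable_mult_indicator[of A M Y] that subalg[of k] by (auto simp: subalgebra_def)
  have V_int: "integrable M (V k)" for k
    unfolding V_def by (intro Bochner_Integration.integrable_add Bochner_Integration.integrable_sum X_int D_int)
  have "AE \<omega> in M. convergent (\<lambda>k. V k \<omega>)"
  proof (rule supermartingale_convergent[where F = F and X = V, OF subalg mono _ V_int])
    show "V k \<in> borel_measurable (F k)" for k
      unfolding V_def using D_meas by (intro borel_measurable_add borel_measurable_sum X_adapted) auto
    show "0 \<le> V k \<omega>" if "\<omega> \<in> space M" for k \<omega>
      unfolding V_def using X_nonneg D_nonneg that by (intro add_nonneg_nonneg sum_nonneg) auto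
    fix k A assume A: "A \<in> sets (F k)"
    define W where "W \<omega> = (\<Sum>j<Suc k. D j \<omega>)" for \<omega>
    have W_int: "integrable M W"
      unfolding W_def by (intro Bochner_Integration.integrable_sum D_int)
    have "(\<integral>\<omega>. indicator A \<omega> * V (Suc k) \<omega> \<partial>M)
        = (\<integral>\<omega>. indicator A \<omega> * X (Suc k) \<omega> \<partial>M) + (\<integral>\<omega>. indicator A \<omega> * W \<omega> \<partial>M)"
      by (subst Bochner_Integration.integral_add[symmetric])
        (auto simp: V_def W_def[symmetric] distrib_left simp del: sum.lessThan_Suc intro!: ind_int[OF A] X_int W_int)
    also have "\<dots> \<le> (\<integral>\<omega>. indicator A \<omega> * (X k \<omega> - D k \<omega>) \<partial>M) + (\<integral>\<omega>. indicator A \<omega> * W \<omega> \<partial>M)"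
      using super[OF A] by simp
    also have "\<dots> = (\<integral>\<omega>. indicator A \<omega> * V k \<omega> \<partial>M)"
      by (subst Bochner_Integration.integral_add[symmetric])
        (auto simp: V_def W_def intro!: ind_int[OF A] Bochner_Integration.integrable_diff X_int W_int D_int
          Bochner_Integration.integral_cong simp flip: distrib_left)
    finally show "(\<integral>\<omega>. indicator A \<omega> * V (Suc k) \<omega> \<partial>M) \<le> (\<integral>\<omega>. indicator A \<omega> * V k \<omega> \<partial>M)" .
  qed
  with AE_space show ?thesis
  proof eventually_elim
    case (elim \<omega>)
    obtain K where K: "\<And>k. \<bar>V k \<omega>\<bar> \<le> K"
      using convergent_imp_Bseq[OF elim(2)] by (auto simp: Bseq_def)
    have "(\<Sum>j<k. D j \<omega>) \<le> K" for k
      using K[of k] X_nonneg[OF elim(1), of k] by (simp add: V_def)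
    then have D_sum: "summable (\<lambda>k. D k \<omega>)"
      using D_nonneg[OF elim(1)] by (intro summableI_nonneg_bounded) auto
    then have "convergent (\<lambda>k. V k \<omega> - (\<Sum>j<k. D j \<omega>))"
      using elim(2) by (intro convergent_diff) (auto simp: summable_iff_convergent)
    with D_sum show ?case by (simp add: V_def)
  qed
qed

section \<open>Conditional expectation, independence and measurability\<close>

text \<open>The bound \<open>g\<close> has to be measurable for the conditioning algebra only after a change on a null set.
  This is the situation of the iterates, which are functions of the history up to a null set.\<close>

lemma (in prob_space) real_cond_exp_le:
  fixes f g :: "'a \<Rightarrow> real"
  assumes subalg: "subalgebra M F" and f: "integrable M f" and g: "integrable M g"
    and g': "g' \<in> borel_measurable F" "AE \<omega> in M. g \<omega> = g' \<omega>"
    and le: "\<And>A. A \<in> sets F \<Longrightarrow> (\<integral>\<omega>. indicator A \<omega> * f \<omega> \<partial>M) \<le> (\<integral>\<omega>. indicator A \<omega> * g \<omega> \<partial>M)"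
  shows "AE \<omega> in M. real_cond_exp M F f \<omega> \<le> g \<omega>"
proof -
  interpret finite_measure_subalgebra M F by standard (rule subalg)
  define h where "h = real_cond_exp M F f"
  have h_int: "integrable M h" unfolding h_def by (rule real_cond_exp_int(1)[OF f])
  have [measurable]: "h \<in> borel_measurable F" unfolding h_def by simp
  note [measurable] = g'(1)
  have [measurable]: "h \<in> borel_measurable M" "g' \<in> borel_measurable M" "g \<in> borel_measurable M"
    using h_int measurable_from_subalg[OF subalg g'(1)] g by blast+
  define A where "A = {\<omega> \<in> space F. g' \<omega> < h \<omega>}"
  have A: "A \<in> sets F" unfolding A_def by measurable
  then have A_M: "A \<in> sets M" using subalg by (auto simp: subalgebra_def)
  have ind_int: "integrable M (\<lambda>\<omega>. indicator A \<omega> * Y \<omega>)" if "integrable M Y" for Y :: "'a \<Rightarrow> real"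
    using integrable_mult_indicator[OF A_M that] by simp
  have g'_int: "integrable M g'"
    using g g'(2) by (intro integrable_cong_AE_imp[OF g]) auto
  have "(\<integral>\<omega>. indicator A \<omega> * h \<omega> \<partial>M) = (\<integral>\<omega>. indicator A \<omega> * f \<omega> \<partial>M)"
    using real_cond_exp_intA[OF f A] by (simp add: h_def set_lebesgue_integral_def)
  also have "\<dots> \<le> (\<integral>\<omega>. indicator A \<omega> * g \<omega> \<partial>M)" by (rule le[OF A])
  also have "\<dots> = (\<integral>\<omega>. indicator A \<omega> * g' \<omega> \<partial>M)"
    using g'(2) A_M by (intro integral_cong_AE) auto
  finally have "(\<integral>\<omega>. indicator A \<omega> * (h \<omega> - g' \<omega>) \<partial>M) \<le> 0"
    by (simp add: right_diff_distrib Bochner_Integration.integral_diff ind_int h_int g'_int)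
  moreover have nonneg: "0 \<le> indicator A \<omega> * (h \<omega> - g' \<omega>)" for \<omega>
    by (auto simp: A_def indicator_def)
  moreover have int: "integrable M (\<lambda>\<omega>. indicator A \<omega> * (h \<omega> - g' \<omega>))"
    by (intro ind_int Bochner_Integration.integrable_diff h_int g'_int)
  ultimately have "AE \<omega> in M. indicator A \<omega> * (h \<omega> - g' \<omega>) = 0"
    by (subst integral_nonneg_eq_0_iff_AE[symmetric]) (auto intro!: antisym integral_nonneg)
  with AE_space g'(2) show ?thesis
    unfolding h_def[symmetric]
  proof eventually_elim
    case (elim \<omega>)
    then show ?case using subalg by (auto simp: A_def indicator_def subalgebra_def split: if_splits)
  qed
qed

lemma measurable_if_vimage_algebra_subset:
  assumes "sets (vimage_algebra (space G) f N) \<subseteq> sets G" "f \<in> space G \<rightarrow> space N"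
  shows "f \<in> measurable G N"
  using measurable_from_subalg[of G "vimage_algebra (space G) f N" f N] assms measurable_vimage_algebra1[OF assms(2)]
  by (simp add: subalgebra_def)

text \<open>The form of independence used for the draws of one iteration: the event is decided by the new draw,
  the function by the past.\<close>

lemma (in prob_space) integral_indicator_indep:
  fixes f :: "'a \<Rightarrow> real"
  assumes indep: "indep_set (sets H) (sets G)" and H: "subalgebra M H" and G: "subalgebra M G"
    and S: "S \<in> sets H" and f: "f \<in> borel_measurable G" "integrable M f"
  shows "(\<integral>\<omega>. indicator S \<omega> * f \<omega> \<partial>M) = prob S * (\<integral>\<omega>. f \<omega> \<partial>M)"
proof -
  have gen: "sigma_sets (space M) {g -` U \<inter> space M | U. U \<in> sets borel} \<subseteq> sets F"
    if F: "subalgebra M F" and g: "g \<in> borel_measurable F" for F and g :: "'a \<Rightarrow> real"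
  proof -
    have sp: "space M = space F" using F by (simp add: subalgebra_def)
    show ?thesis unfolding sp by (rule sets.sigma_sets_subset) (use g in \<open>auto intro: measurable_sets\<close>)
  qed
  have ind: "(indicator S :: 'a \<Rightarrow> real) \<in> borel_measurable H" using S by simp
  have "indep_set (sigma_sets (space M) {indicator S -` U \<inter> space M | U. U \<in> sets (borel :: real measure)})
      (sigma_sets (space M) {f -` U \<inter> space M | U. U \<in> sets borel})"
    using indep gen[OF H ind] gen[OF G f(1)] unfolding indep_set_def
    by (elim indep_sets_mono_sets) (auto split: bool.splits)
  then have "indep_var borel (indicator S :: 'a \<Rightarrow> real) borel f"
    unfolding indep_var_eq
    using measurable_from_subalg[OF H ind] measurable_from_subalg[OF G f(1)] by blast
  moreover have S_M: "S \<in> sets M" using S H by (auto simp: subalgebra_def)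
  then have "integrable M (indicator S :: 'a \<Rightarrow> real)"
    by (simp add: emeasure_finite less_top[symmetric])
  ultimately show ?thesis
    using indep_var_lebesgue_integral[OF _ _ f(2)] sets.Int_space_eq2[OF S_M] by simp
qed

text \<open>Pettis' theorem. In a separable space, \<open>norm v \<le> r\<close> is a countable conjunction of conditions on the
  inner products of \<open>v\<close>, so distances to fixed points are measurable; balls of rational radius around the
  points of a countable dense set then generate the open sets.\<close>

lemma borel_measurable_weakly:
  fixes f :: "'w \<Rightarrow> 'a::{real_inner,second_countable_topology}"
  assumes weak: "\<And>z. (\<lambda>\<omega>. inner (f \<omega>) z) \<in> borel_measurable M"
  shows "f \<in> borel_measurable M"
proof -
  obtain D :: "'a set" where D: "countable D" "closure D = UNIV"
    using separable[of UNIV] by (metis UNIV_I subset_antisym subset_UNIV)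
  have norm_le: "norm v \<le> r \<longleftrightarrow> 0 \<le> r \<and> (\<forall>d\<in>D. inner v d \<le> r * norm d)" for v :: 'a and r
  proof safe
    assume "norm v \<le> r"
    then show "0 \<le> r" using norm_ge_zero order_trans by blast
    fix d show "inner v d \<le> r * norm d"
      using norm_cauchy_schwarz[of v d] \<open>norm v \<le> r\<close> mult_right_mono[of "norm v" r "norm d"] by simp
  next
    assume *: "0 \<le> r" "\<forall>d\<in>D. inner v d \<le> r * norm d"
    have "closed {d. inner v d \<le> r * norm d}"
      by (intro closed_Collect_le continuous_intros)
    with * D have "v \<in> {d. inner v d \<le> r * norm d}"
      by (metis (no_types, lifting) UNIV_I closure_minimal mem_Collect_eq subsetD subsetI)
    then have "norm v * norm v \<le> r * norm v" by (simp add: power2_eq_square flip: power2_norm_eq_inner)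
    with \<open>0 \<le> r\<close> show "norm v \<le> r"
      by (cases "norm v = 0") (auto simp: mult_le_cancel_right)
  qed
  have ball: "{\<omega> \<in> space M. dist d (f \<omega>) < q} \<in> sets M" for d q
  proof -
    have "(\<lambda>\<omega>. norm (f \<omega> - d)) \<in> borel_measurable M"
    proof (rule borel_measurableI_le)
      fix r
      have "{\<omega> \<in> space M. norm (f \<omega> - d) \<le> r}
          = {\<omega> \<in> space M. 0 \<le> r \<and> (\<forall>e\<in>D. inner (f \<omega>) e - inner d e \<le> r * norm e)}"
        by (simp add: norm_le inner_diff)
      also have "\<dots> \<in> sets M"
        using D(1) weak by measurable
      finally show "{\<omega> \<in> space M. norm (f \<omega> - d) \<le> r} \<in> sets M" .
    qed
    then show ?thesis by (simp add: dist_norm norm_minus_commute)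
  qed
  show ?thesis
  proof (rule borel_measurableI)
    fix S :: "'a set" assume "open S"
    define I where "I = {(d, q). d \<in> D \<and> q \<in> \<rat> \<and> ball d q \<subseteq> S}"
    have "countable I"
      by (rule countable_subset[OF _ countable_SIGMA[OF D(1) countable_rat]]) (auto simp: I_def)
    have "f -` S \<inter> space M = (\<Union>(d, q)\<in>I. {\<omega> \<in> space M. dist d (f \<omega>) < q})"
    proof (intro equalityI subsetI)
      fix \<omega> assume \<omega>: "\<omega> \<in> f -` S \<inter> space M"
      then obtain e where e: "e > 0" "ball (f \<omega>) e \<subseteq> S"
        using \<open>open S\<close> openE by blast
      obtain d where d: "d \<in> D" "dist d (f \<omega>) < e / 4"
        using D(2) e closure_approachable[of "f \<omega>" D] by (metis UNIV_I divide_pos_pos zero_less_numeral)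
      obtain q where q: "q \<in> \<rat>" "e / 4 < q" "q < e / 2"
        using Rats_dense_in_real[of "e / 4" "e / 2"] e by auto
      have "ball d q \<subseteq> ball (f \<omega>) e"
      proof
        fix v assume "v \<in> ball d q"
        then show "v \<in> ball (f \<omega>) e"
          using d q dist_triangle[of "f \<omega>" v d] by (simp add: dist_commute)
      qed
      then have "(d, q) \<in> I" using d q e by (auto simp: I_def)
      then show "\<omega> \<in> (\<Union>(d, q)\<in>I. {\<omega> \<in> space M. dist d (f \<omega>) < q})"
        using d q \<omega> by force
    qed (auto simp: I_def subset_iff)
    also have "\<dots> \<in> sets M"
      using \<open>countable I\<close> ball by (intro sets.countable_UN') auto
    finally show "f -` S \<inter> space M \<in> sets M" .
  qed
qed

section \<open>One step of the splitting method\<close>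

text \<open>The upper bound on \<open>\<gamma>\<close> is the positive root of \<open>L\<^sup>2 \<gamma>\<^sup>2 + \<gamma> / (2 \<beta>) = 1 - \<lambda>\<close>, written with a
  rationalised numerator.\<close>

lemma step_size_gap:
  fixes \<beta> L lam \<gamma> :: real
  assumes "\<beta> > 0" "L > 0" "lam < 1"
    and \<gamma>: "\<gamma> \<in> {0 <..< 4 * \<beta> * (1 - lam) / (1 + sqrt (1 + 16 * \<beta>\<^sup>2 * L\<^sup>2 * (1 - lam)))}"
  shows "\<gamma> / (2 * \<beta>) + \<gamma>\<^sup>2 * L\<^sup>2 < 1 - lam"
proof -
  define s where "s = sqrt (1 + 16 * \<beta>\<^sup>2 * L\<^sup>2 * (1 - lam))"
  have s2: "s\<^sup>2 = 1 + 16 * \<beta>\<^sup>2 * L\<^sup>2 * (1 - lam)" and "s \<ge> 0"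
    using assms unfolding s_def by (auto intro!: real_sqrt_pow2 add_nonneg_nonneg)
  have "\<gamma> * (1 + s) < 4 * \<beta> * (1 - lam)"
    using \<gamma> \<open>s \<ge> 0\<close> unfolding s_def[symmetric] by (simp add: pos_less_divide_eq)
  then have "(4 * \<beta> * L\<^sup>2) * (\<gamma> * (1 + s)) < (4 * \<beta> * L\<^sup>2) * (4 * \<beta> * (1 - lam))"
    using assms by (intro mult_strict_left_mono) auto
  also have "\<dots> = s\<^sup>2 - 1" unfolding s2 by (simp add: power2_eq_square)
  also have "\<dots> = (s - 1) * (1 + s)" by (simp add: power2_eq_square algebra_simps)
  finally have "(4 * \<beta> * L\<^sup>2 * \<gamma>) * (1 + s) < (s - 1) * (1 + s)" by (simp add: mult.assoc)
  then have "4 * \<beta> * L\<^sup>2 * \<gamma> + 1 < s"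
    using \<open>s \<ge> 0\<close> by (simp add: mult_less_cancel_right)
  then have "(4 * \<beta> * L\<^sup>2 * \<gamma> + 1)\<^sup>2 < s\<^sup>2"
    using assms \<gamma> by (intro power_strict_mono) auto
  then have "(8 * \<beta> * L\<^sup>2) * (2 * \<beta> * L\<^sup>2 * \<gamma>\<^sup>2 + \<gamma>) < (8 * \<beta> * L\<^sup>2) * (2 * \<beta> * (1 - lam))"
    unfolding s2 by (simp add: power2_eq_square algebra_simps)
  then have "2 * \<beta> * L\<^sup>2 * \<gamma>\<^sup>2 + \<gamma> < 2 * \<beta> * (1 - lam)"
    using assms by (simp add: mult_less_cancel_left)
  then show ?thesis using \<open>\<beta> > 0\<close> by (simp add: field_simps)
qed

lemma expectation_finite_pmf:
  fixes f :: "'i \<Rightarrow> 'b::{banach,second_countable_topology}"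
  assumes "finite (set_pmf Q)"
  shows "measure_pmf.expectation Q f = (\<Sum>i\<in>set_pmf Q. pmf Q i *\<^sub>R f i)"
  by (rule integral_measure_pmf) (use assms in auto)

text \<open>The deterministic side of the method: everything about a single step in which the draws enter only
  through the finite distribution \<open>Q\<close>.\<close>

locale splitting =
  fixes A :: "'a::{real_inner,banach,second_countable_topology} \<Rightarrow> 'a set"
    and B C :: "'a \<Rightarrow> 'a" and Q :: "nat pmf" and Bo :: "nat \<Rightarrow> 'a \<Rightarrow> 'a"
    and K L \<beta> lam \<gamma> :: real
  assumes A_max: "maximally_monotone A"
    and B_mono: "\<And>u v. 0 \<le> inner (B u - B v) (u - v)"
    and B_lip: "K-lipschitz_on UNIV B"
    and Q_fin: "finite (set_pmf Q)"
    and unbiased: "\<And>u. B u = measure_pmf.expectation Q (\<lambda>i. Bo i u)"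
    and mean_lip: "\<And>u v. measure_pmf.expectation Q (\<lambda>i. (norm (Bo i u - Bo i v))\<^sup>2)
                     \<le> L\<^sup>2 * (norm (u - v))\<^sup>2"
    and beta_pos: "\<beta> > 0"
    and C_coco: "cocoercive \<beta> C"
    and lam: "0 \<le> lam" "lam < 1"
    and gamma_pos: "\<gamma> > 0"
    and gamma: "\<gamma> / (2 * \<beta>) + \<gamma>\<^sup>2 * L\<^sup>2 < 1 - lam"
begin

text \<open>The guaranteed decrease per unit of \<open>\<parallel>w - y\<parallel>\<^sup>2\<close>.\<close>

definition \<epsilon> :: real where "\<epsilon> = 1 - lam - \<gamma> / (2 * \<beta>) - \<gamma>\<^sup>2 * L\<^sup>2"

definition T :: "'a \<Rightarrow> 'a set" where "T x = (\<lambda>u. u + (B x + C x)) ` A x"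

text \<open>The names follow Tseng's forward-backward-forward scheme: \<open>backward\<close> is the resolvent step, and
  \<open>forward i\<close> corrects it by re-evaluating the oracle value \<open>i\<close>, which gives the next iterate.\<close>

definition backward :: "'a \<Rightarrow> 'a \<Rightarrow> 'a" where
  "backward x w = resolvent (scale_operator \<gamma> A)
     ((lam *\<^sub>R x + (1 - lam) *\<^sub>R w) - \<gamma> *\<^sub>R (B w + C w))"

definition forward :: "nat \<Rightarrow> 'a \<Rightarrow> 'a \<Rightarrow> 'a" where
  "forward i x w = backward x w + \<gamma> *\<^sub>R (Bo i w - Bo i (backward x w))"

lemma eps_pos: "\<epsilon> > 0"
  using gamma by (simp add: \<epsilon>_def)

lemma C_mono: "0 \<le> inner (C u - C v) (u - v)"
  using C_coco beta_pos unfolding cocoercive_def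
  by (meson less_imp_le mult_nonneg_nonneg order_trans zero_le_power2)

lemma C_lip: "(1 / \<beta>)-lipschitz_on UNIV C"
proof (rule lipschitz_onI)
  fix u v
  have "\<beta> * (norm (C u - C v))\<^sup>2 \<le> norm (C u - C v) * norm (u - v)"
    using C_coco norm_cauchy_schwarz[of "C u - C v" "u - v"] unfolding cocoercive_def
    by (meson order_trans)
  then have "\<beta> * norm (C u - C v) \<le> norm (u - v)"
    by (cases "norm (C u - C v) = 0") (auto simp: power2_eq_square mult.assoc mult.left_commute)
  then show "dist (C u) (C v) \<le> 1 / \<beta> * dist u v"
    using beta_pos by (simp add: dist_norm field_simps)
qed (use beta_pos in auto)

lemma BC_lip: "(K + 1 / \<beta>)-lipschitz_on UNIV (\<lambda>x. B x + C x)"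
  by (rule lipschitz_on_add[OF B_lip C_lip])

lemma BC_lipD: "norm ((B u + C u) - (B v + C v)) \<le> (K + 1 / \<beta>) * norm (u - v)"
  using BC_lip by (auto simp: lipschitz_on_def dist_norm)

lemma T_max: "maximally_monotone T"
proof -
  have "0 \<le> inner ((B u + C u) - (B v + C v)) (u - v)" for u v
    using B_mono[of u v] C_mono[of u v] by (simp add: inner_diff_left inner_add_left)
  then show ?thesis
    unfolding T_def[abs_def] by (rule maximally_monotone_add_Lipschitz[OF A_max _ BC_lip])
qed

lemma zeros3_eq: "zeros3 A B C = {x. 0 \<in> T x}"
  by (simp add: zeros3_def T_def add.assoc)

lemma scaled_A_max: "maximally_monotone (scale_operator \<gamma> A)"
  by (rule maximally_monotone_scale[OF A_max gamma_pos])

lemma backward_mem: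
  "(1 / \<gamma>) *\<^sub>R (lam *\<^sub>R x + (1 - lam) *\<^sub>R w - backward x w) - (B w + C w) \<in> A (backward x w)"
proof -
  have "(lam *\<^sub>R x + (1 - lam) *\<^sub>R w) - \<gamma> *\<^sub>R (B w + C w) - backward x w \<in> scale_operator \<gamma> A (backward x w)"
    using resolvent_eq_iff[OF scaled_A_max] unfolding backward_def by blast
  then obtain u where "u \<in> A (backward x w)"
      "lam *\<^sub>R x + (1 - lam) *\<^sub>R w - backward x w - \<gamma> *\<^sub>R (B w + C w) = \<gamma> *\<^sub>R u"
    unfolding scale_operator_def by (auto simp: algebra_simps)
  moreover from this(2) have "u = (1 / \<gamma>) *\<^sub>R (lam *\<^sub>R x + (1 - lam) *\<^sub>R w - backward x w) - (B w + C w)"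
  proof -
    have "(1 / \<gamma>) *\<^sub>R (lam *\<^sub>R x + (1 - lam) *\<^sub>R w - backward x w)
        = (1 / \<gamma>) *\<^sub>R (\<gamma> *\<^sub>R u + \<gamma> *\<^sub>R (B w + C w))"
      using calculation(2) by (metis diff_add_cancel)
    then show ?thesis using gamma_pos by (simp flip: scaleR_add_right)
  qed
  ultimately show ?thesis by simp
qed

text \<open>The element of \<open>T y\<close> that the resolvent step exhibits; it vanishes with \<open>x - y\<close> and \<open>w - y\<close>.\<close>

lemma residual_mem:
  "(1 / \<gamma>) *\<^sub>R (lam *\<^sub>R x + (1 - lam) *\<^sub>R w - backward x w)
     + ((B (backward x w) + C (backward x w)) - (B w + C w)) \<in> T (backward x w)"
  unfolding T_def using backward_mem[of x w] by (force simp: algebra_simps image_iff)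

text \<open>The mean of the next squared distance is expanded with unbiasedness and the Lipschitz bound in mean.
  In \<open>2 \<gamma> \<langle>B w - B y, y - z\<rangle>\<close> the term \<open>B w\<close> cancels against the forward evaluation inside the
  resolvent, leaving \<open>- 2 \<gamma> \<langle>B y - B z, y - z\<rangle> \<le> 0\<close>. Cocoercivity absorbs the fact that \<open>C\<close> is evaluated
  at \<open>w\<close> instead of \<open>y\<close>, at the cost \<open>\<gamma> / (2 \<beta>) \<parallel>w - y\<parallel>\<^sup>2\<close>.\<close>

lemma descent:
  assumes z: "z \<in> zeros3 A B C"
  shows "(\<Sum>i\<in>set_pmf Q. pmf Q i * (norm (forward i x w - z))\<^sup>2)
    \<le> lam * (norm (x - z))\<^sup>2 + (1 - lam) * (norm (w - z))\<^sup>2 - \<epsilon> * (norm (w - backward x w))\<^sup>2"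
proof -
  define y where "y = backward x w"
  define d where "d i = Bo i w - Bo i y" for i
  have sum_pmf: "(\<Sum>i\<in>set_pmf Q. pmf Q i) = 1"
    using sum_pmf_eq_1[OF Q_fin order_refl] .
  have mean_d: "(\<Sum>i\<in>set_pmf Q. pmf Q i *\<^sub>R d i) = B w - B y"
    unfolding d_def unbiased expectation_finite_pmf[OF Q_fin]
    by (simp add: scaleR_diff_right sum_subtractf)
  have var_d: "(\<Sum>i\<in>set_pmf Q. pmf Q i * (norm (d i))\<^sup>2) \<le> L\<^sup>2 * (norm (w - y))\<^sup>2"
    using mean_lip[of w y] by (simp add: expectation_finite_pmf[OF Q_fin] d_def)
  have sq: "(norm (forward i x w - z))\<^sup>2
      = (norm (y - z))\<^sup>2 + 2 * \<gamma> * inner (d i) (y - z) + \<gamma>\<^sup>2 * (norm (d i))\<^sup>2" for i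
  proof -
    have "forward i x w - z = (y - z) + \<gamma> *\<^sub>R d i" by (simp add: forward_def y_def d_def)
    then show ?thesis
      unfolding power2_norm_eq_inner
      by (simp add: inner_add_left inner_add_right inner_diff_left inner_diff_right inner_commute
          power2_eq_square algebra_simps)
  qed
  have "(\<Sum>i\<in>set_pmf Q. pmf Q i * (norm (forward i x w - z))\<^sup>2)
      = (\<Sum>i\<in>set_pmf Q. pmf Q i * (norm (y - z))\<^sup>2 + 2 * \<gamma> * inner (pmf Q i *\<^sub>R d i) (y - z)
          + \<gamma>\<^sup>2 * (pmf Q i * (norm (d i))\<^sup>2))"
    by (rule sum.cong) (simp_all only: sq inner_scaleR_left distrib_left ac_simps)
  also have "\<dots> = (norm (y - z))\<^sup>2 + 2 * \<gamma> * inner (B w - B y) (y - z)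
      + \<gamma>\<^sup>2 * (\<Sum>i\<in>set_pmf Q. pmf Q i * (norm (d i))\<^sup>2)"
    unfolding mean_d[symmetric] inner_sum_left
    by (simp add: sum.distrib sum_pmf flip: sum_distrib_left sum_distrib_right)
  also have "\<dots> \<le> (norm (y - z))\<^sup>2 + 2 * \<gamma> * inner (B w - B y) (y - z) + \<gamma>\<^sup>2 * (L\<^sup>2 * (norm (w - y))\<^sup>2)"
    using var_d by (intro add_left_mono mult_left_mono) auto
  finally have expand: "(\<Sum>i\<in>set_pmf Q. pmf Q i * (norm (forward i x w - z))\<^sup>2)
      \<le> (norm (y - z))\<^sup>2 + 2 * \<gamma> * inner (B w - B y) (y - z) + \<gamma>\<^sup>2 * L\<^sup>2 * (norm (w - y))\<^sup>2"
    by (simp add: mult.assoc)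
  have "- (B z + C z) \<in> A z"
  proof -
    obtain u where "u \<in> A z" "u + (B z + C z) = 0"
      using z by (auto simp: zeros3_def add.assoc)
    then show ?thesis by (metis eq_neg_iff_add_eq_0)
  qed
  then have "0 \<le> inner ((1 / \<gamma>) *\<^sub>R (lam *\<^sub>R x + (1 - lam) *\<^sub>R w - y) - (B w + C w) - - (B z + C z)) (y - z)"
    using A_max backward_mem[of x w] unfolding maximally_monotone_def monotone_operator_def y_def by blast
  then have "0 \<le> (1 / \<gamma>) * inner (lam *\<^sub>R x + (1 - lam) *\<^sub>R w - y) (y - z)
      - inner (B w - B z) (y - z) - inner (C w - C z) (y - z)"
    by (simp add: inner_diff_left inner_add_left inner_left_distrib algebra_simps)
  then have "0 \<le> (2 * \<gamma>) * ((1 / \<gamma>) * inner (lam *\<^sub>R x + (1 - lam) *\<^sub>R w - y) (y - z)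
      - inner (B w - B z) (y - z) - inner (C w - C z) (y - z))"
    using gamma_pos by (intro mult_nonneg_nonneg) auto
  also have "\<dots> = 2 * inner (lam *\<^sub>R x + (1 - lam) *\<^sub>R w - y) (y - z)
      - 2 * \<gamma> * inner (B w - B z) (y - z) - 2 * \<gamma> * inner (C w - C z) (y - z)"
    using gamma_pos by (simp add: algebra_simps)
  finally have mono: "0 \<le> 2 * inner (lam *\<^sub>R x + (1 - lam) *\<^sub>R w - y) (y - z)
      - 2 * \<gamma> * inner (B w - B z) (y - z) - 2 * \<gamma> * inner (C w - C z) (y - z)" .
  have three_point: "2 * inner (a - y) (y - z) = (norm (a - z))\<^sup>2 - (norm (a - y))\<^sup>2 - (norm (y - z))\<^sup>2" for a
    by (simp add: power2_norm_eq_inner inner_diff inner_commute)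
  have "lam *\<^sub>R x + (1 - lam) *\<^sub>R w - y = lam *\<^sub>R (x - y) + (1 - lam) *\<^sub>R (w - y)"
    by (simp add: algebra_simps)
  then have "2 * inner (lam *\<^sub>R x + (1 - lam) *\<^sub>R w - y) (y - z)
      = lam * (2 * inner (x - y) (y - z)) + (1 - lam) * (2 * inner (w - y) (y - z))"
    by (simp add: inner_add_left)
  also have "\<dots> = lam * ((norm (x - z))\<^sup>2 - (norm (x - y))\<^sup>2) + (1 - lam) * ((norm (w - z))\<^sup>2 - (norm (w - y))\<^sup>2)
      - (norm (y - z))\<^sup>2"
    unfolding three_point by (simp add: algebra_simps)
  finally have avg: "2 * inner (lam *\<^sub>R x + (1 - lam) *\<^sub>R w - y) (y - z)
      = lam * ((norm (x - z))\<^sup>2 - (norm (x - y))\<^sup>2) + (1 - lam) * ((norm (w - z))\<^sup>2 - (norm (w - y))\<^sup>2)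
      - (norm (y - z))\<^sup>2" .
  have B_part: "inner (B w - B y) (y - z) - inner (B w - B z) (y - z) \<le> 0"
    using B_mono[of y z] by (simp add: inner_diff_left)
  have C_part: "- inner (C w - C z) (y - z) \<le> (norm (w - y))\<^sup>2 / (4 * \<beta>)"
  proof -
    define c where "c = norm (C w - C z)"
    define n where "n = norm (w - y)"
    have "- inner (C w - C z) (y - z) = inner (C w - C z) (w - y) - inner (C w - C z) (w - z)"
      by (simp add: inner_diff_right)
    also have "\<dots> \<le> c * n - \<beta> * c\<^sup>2"
      using norm_cauchy_schwarz[of "C w - C z" "w - y"] C_coco
      unfolding cocoercive_def c_def n_def by (intro diff_mono) auto
    also have "\<dots> \<le> n\<^sup>2 / (4 * \<beta>)"
    proof -
      \<comment> \<open>Young's inequality with the weight that uses up all of the cocoercivity.\<close>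
      have "0 \<le> (2 * \<beta> * c - n)\<^sup>2 / (4 * \<beta>)" using beta_pos by simp
      also have "\<dots> = n\<^sup>2 / (4 * \<beta>) - (c * n - \<beta> * c\<^sup>2)"
        using beta_pos by (simp add: power2_eq_square field_simps)
      finally show ?thesis by simp
    qed
    finally show ?thesis unfolding n_def .
  qed
  have "2 * \<gamma> * (inner (B w - B y) (y - z) - inner (B w - B z) (y - z)) \<le> 0"
    using B_part gamma_pos by (simp add: mult_nonneg_nonpos)
  moreover have "2 * \<gamma> * (- inner (C w - C z) (y - z)) \<le> 2 * \<gamma> * ((norm (w - y))\<^sup>2 / (4 * \<beta>))"
    using C_part gamma_pos by (intro mult_left_mono) auto
  moreover have "0 \<le> lam * (norm (x - y))\<^sup>2" using lam by simp
  moreover have "\<epsilon> * (norm (w - y))\<^sup>2 = (1 - lam) * (norm (w - y))\<^sup>2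
      - 2 * \<gamma> * ((norm (w - y))\<^sup>2 / (4 * \<beta>)) - \<gamma>\<^sup>2 * L\<^sup>2 * (norm (w - y))\<^sup>2"
    using beta_pos by (simp add: \<epsilon>_def field_simps)
  ultimately show ?thesis
    using expand mono avg unfolding y_def[symmetric] by (simp add: algebra_simps)
qed

text \<open>A value drawn with positive probability contributes a fixed fraction to the mean, so it inherits a
  Lipschitz constant from the bound in mean. About values of probability zero nothing is known.\<close>

lemma oracle_lipschitz:
  obtains Lo where "Lo \<ge> 0" "\<And>i u v. i \<in> set_pmf Q \<Longrightarrow> norm (Bo i u - Bo i v) \<le> Lo * norm (u - v)"
proof
  define Lo where "Lo = (\<Sum>i\<in>set_pmf Q. \<bar>L\<bar> / sqrt (pmf Q i))"
  show "Lo \<ge> 0" by (simp add: Lo_def sum_nonneg)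
  fix i u v assume i: "i \<in> set_pmf Q"
  then have pos: "pmf Q i > 0" by (rule pmf_positive)
  have "pmf Q i * (norm (Bo i u - Bo i v))\<^sup>2 \<le> (\<Sum>j\<in>set_pmf Q. pmf Q j * (norm (Bo j u - Bo j v))\<^sup>2)"
    using Q_fin i by (intro member_le_sum) auto
  also have "\<dots> \<le> L\<^sup>2 * (norm (u - v))\<^sup>2"
    using mean_lip[of u v] by (simp add: expectation_finite_pmf[OF Q_fin])
  finally have "(sqrt (pmf Q i) * norm (Bo i u - Bo i v))\<^sup>2 \<le> (\<bar>L\<bar> * norm (u - v))\<^sup>2"
    by (simp add: power_mult_distrib)
  then have "sqrt (pmf Q i) * norm (Bo i u - Bo i v) \<le> \<bar>L\<bar> * norm (u - v)"
    by (rule power2_le_imp_le) simp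
  then have "norm (Bo i u - Bo i v) \<le> \<bar>L\<bar> / sqrt (pmf Q i) * norm (u - v)"
    using pos by (simp add: field_simps)
  also have "\<dots> \<le> Lo * norm (u - v)"
    unfolding Lo_def using Q_fin i by (intro mult_right_mono member_le_sum) auto
  finally show "norm (Bo i u - Bo i v) \<le> Lo * norm (u - v)" .
qed

lemma oracle_continuous: "i \<in> set_pmf Q \<Longrightarrow> continuous_on UNIV (Bo i)"
  using oracle_lipschitz lipschitz_on_continuous_on[of _ UNIV "Bo i"]
  by (metis dist_norm lipschitz_onI)

lemma backward_continuous: "continuous_on UNIV (\<lambda>e. backward (fst e) (snd e))"
proof -
  have "1-lipschitz_on UNIV (resolvent (scale_operator \<gamma> A))"
    by (intro lipschitz_onI) (auto simp: dist_norm resolvent_nonexpansive[OF scaled_A_max])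
  then have "continuous_on UNIV (resolvent (scale_operator \<gamma> A))"
    by (rule lipschitz_on_continuous_on)
  moreover have "continuous_on UNIV (\<lambda>e. B (snd e))" "continuous_on UNIV (\<lambda>e. C (snd e))"
    by (rule continuous_on_compose2[OF lipschitz_on_continuous_on[OF B_lip] continuous_on_snd[OF continuous_on_id]]
        continuous_on_compose2[OF lipschitz_on_continuous_on[OF C_lip] continuous_on_snd[OF continuous_on_id]], simp)+
  then have "continuous_on UNIV (\<lambda>e. (lam *\<^sub>R fst e + (1 - lam) *\<^sub>R snd e) - \<gamma> *\<^sub>R (B (snd e) + C (snd e)))"
    by (intro continuous_intros)
  ultimately show ?thesis
    unfolding backward_def by (rule continuous_on_compose2) auto
qed

lemma backward_bounded:
  obtains K' where "\<And>x w. norm x \<le> R \<Longrightarrow> norm w \<le> R \<Longrightarrow> norm (backward x w) \<le> K'"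
proof
  fix x w :: 'a assume xw: "norm x \<le> R" "norm w \<le> R"
  have "norm (backward x w) \<le> norm (backward 0 0) + norm (backward x w - backward 0 0)"
    by (metis add.commute diff_add_cancel norm_triangle_ineq)
  also have "norm (backward x w - backward 0 0)
      \<le> norm (lam *\<^sub>R x + (1 - lam) *\<^sub>R w - \<gamma> *\<^sub>R ((B w + C w) - (B 0 + C 0)))"
    using resolvent_nonexpansive[OF scaled_A_max,
        of "(lam *\<^sub>R x + (1 - lam) *\<^sub>R w) - \<gamma> *\<^sub>R (B w + C w)" "0 - \<gamma> *\<^sub>R (B 0 + C 0)"]
    by (simp add: backward_def algebra_simps)
  also have "\<dots> \<le> norm (lam *\<^sub>R x) + norm ((1 - lam) *\<^sub>R w) + norm (\<gamma> *\<^sub>R ((B w + C w) - (B 0 + C 0)))"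
    by (meson add_mono norm_triangle_ineq norm_triangle_ineq4 order_refl order_trans)
  also have "\<dots> \<le> 1 * R + 1 * R + \<gamma> * ((K + 1 / \<beta>) * R)"
  proof (intro add_mono)
    show "norm (lam *\<^sub>R x) \<le> 1 * R" "norm ((1 - lam) *\<^sub>R w) \<le> 1 * R"
      using lam xw mult_left_le_one_le[of "norm x" lam] mult_left_le_one_le[of "norm w" "1 - lam"] by auto
    have "0 \<le> K + 1 / \<beta>" using BC_lip lipschitz_on_nonneg by blast
    then have "norm ((B w + C w) - (B 0 + C 0)) \<le> (K + 1 / \<beta>) * R"
      using order_trans[OF BC_lipD[of w 0] mult_left_mono[of "norm (w - 0)" R]] xw by simp
    then show "norm (\<gamma> *\<^sub>R ((B w + C w) - (B 0 + C 0))) \<le> \<gamma> * ((K + 1 / \<beta>) * R)"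
      using gamma_pos by (simp add: mult_left_mono)
  qed
  finally show "norm (backward x w) \<le> norm (backward 0 0) + (1 * R + 1 * R + \<gamma> * ((K + 1 / \<beta>) * R))"
    by simp
qed

lemma forward_near_backward:
  obtains c where "c \<ge> 0"
    "\<And>i x w. i \<in> set_pmf Q \<Longrightarrow> norm (forward i x w - backward x w) \<le> c * norm (w - backward x w)"
proof -
  obtain Lo where "Lo \<ge> 0" "\<And>i u v. i \<in> set_pmf Q \<Longrightarrow> norm (Bo i u - Bo i v) \<le> Lo * norm (u - v)"
    by (rule oracle_lipschitz) blast
  then show ?thesis
    using gamma_pos by (intro that[of "\<gamma> * Lo"]) (auto simp: forward_def mult.assoc)
qed

lemma forward_bounded:
  obtains K' where "\<And>i x w. i \<in> set_pmf Q \<Longrightarrow> norm x \<le> R \<Longrightarrow> norm w \<le> R \<Longrightarrow> norm (forward i x w) \<le> K'"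
proof -
  obtain c where c: "c \<ge> 0"
    "\<And>i x w. i \<in> set_pmf Q \<Longrightarrow> norm (forward i x w - backward x w) \<le> c * norm (w - backward x w)"
    by (rule forward_near_backward) blast
  obtain K1 where K1: "\<And>x w. norm x \<le> R \<Longrightarrow> norm w \<le> R \<Longrightarrow> norm (backward x w) \<le> K1"
    by (rule backward_bounded[of R]) blast
  have "norm (forward i x w) \<le> K1 + c * (R + K1)"
    if "i \<in> set_pmf Q" "norm x \<le> R" "norm w \<le> R" for i x w
  proof -
    have "norm (forward i x w) \<le> norm (backward x w) + norm (forward i x w - backward x w)"
      by (metis add.commute diff_add_cancel norm_triangle_ineq)
    also have "norm (forward i x w - backward x w) \<le> c * norm (w - backward x w)"
      by (rule c(2)[OF that(1)])
    also have "norm (w - backward x w) \<le> norm w + norm (backward x w)" by (rule norm_triangle_ineq4)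
    finally show ?thesis
      using K1[OF that(2,3)] that(3) c(1) by (smt (verit, best) mult_left_mono)
  qed
  then show ?thesis by (rule that)
qed

text \<open>What remains on a single path. From \<open>w - y \<rightarrow> 0\<close> and the Lipschitz oracle one gets
  \<open>x\<^sub>k\<^sub>+\<^sub>1 - w\<^sub>k \<rightarrow> 0\<close>; whichever way the coin falls, \<open>w\<^sub>k\<^sub>+\<^sub>1\<close> is \<open>x\<^sub>k\<^sub>+\<^sub>1\<close> or \<open>w\<^sub>k\<close>, so
  \<open>x - w \<rightarrow> 0\<close> even when \<open>\<lambda> = 0\<close>. Then \<open>\<Phi>\<^sub>k(z)\<close> differs from a multiple of \<open>\<parallel>y\<^sub>k - z\<parallel>\<^sup>2\<close> by a null
  sequence, and the convergence criterion for zeros of \<open>T\<close> applies to \<open>y\<close>.\<close>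

lemma pathwise_weak_convergence:
  assumes step: "\<And>k. \<exists>i\<in>set_pmf Q. x (Suc k) = forward i (x k) (w k)"
    and w_step: "\<And>k. w (Suc k) = x (Suc k) \<or> w (Suc k) = w k"
    and sum: "summable (\<lambda>k. \<epsilon> * (norm (w k - backward (x k) (w k)))\<^sup>2)"
    and p: "p > 0"
    and Phi: "\<And>z. z \<in> D \<Longrightarrow> convergent (\<lambda>k. Phi lam p (x k) (w k) z)"
    and D: "D \<subseteq> zeros3 A B C" "zeros3 A B C \<subseteq> closure D" "z0 \<in> D"
  shows "\<exists>c\<in>zeros3 A B C. weakly_converges x c"
proof -
  define y where "y k = backward (x k) (w k)" for k
  define \<mu> where "\<mu> = (1 - lam) / p"
  have "\<mu> > 0" using lam p by (simp add: \<mu>_def)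
  have "(\<lambda>k. \<epsilon> * (norm (w k - y k))\<^sup>2) \<longlonglongrightarrow> 0"
    using summable_LIMSEQ_zero[OF sum] by (simp add: y_def)
  then have "(\<lambda>k. sqrt (inverse \<epsilon> * (\<epsilon> * (norm (w k - y k))\<^sup>2))) \<longlonglongrightarrow> sqrt (inverse \<epsilon> * 0)"
    by (intro tendsto_intros)
  then have wy: "(\<lambda>k. norm (w k - y k)) \<longlonglongrightarrow> 0"
    using eps_pos by (simp flip: mult.assoc)
  obtain c where c: "c \<ge> 0"
    "\<And>i x w. i \<in> set_pmf Q \<Longrightarrow> norm (forward i x w - backward x w) \<le> c * norm (w - backward x w)"
    by (rule forward_near_backward) blast
  have "norm (x (Suc k) - w (Suc k)) \<le> (1 + c) * norm (w k - y k)" for k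
  proof -
    have "norm (x (Suc k) - y k) \<le> c * norm (w k - y k)"
      using step[of k] c(2) unfolding y_def by metis
    moreover have "norm (x (Suc k) - w k) \<le> norm (x (Suc k) - y k) + norm (w k - y k)"
      using norm_triangle_ineq4[of "x (Suc k) - y k" "w k - y k"] by simp
    ultimately have "norm (x (Suc k) - w k) \<le> (1 + c) * norm (w k - y k)"
      by (simp add: distrib_right)
    then show ?thesis using w_step[of k] c(1) by auto
  qed
  then have "(\<lambda>k. norm (x (Suc k) - w (Suc k))) \<longlonglongrightarrow> 0"
    by (intro Lim_null_comparison[OF _ tendsto_mult_right_zero[OF wy, of "1 + c"]]) auto
  then have xw: "(\<lambda>k. norm (x k - w k)) \<longlonglongrightarrow> 0" by (rule LIMSEQ_imp_Suc)
  have xy: "(\<lambda>k. x k - y k) \<longlonglongrightarrow> 0"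
    using tendsto_add[OF tendsto_norm_zero_cancel[OF xw] tendsto_norm_zero_cancel[OF wy]] by simp
  have conv_D: "convergent (\<lambda>k. norm (y k - z))" if z: "z \<in> D" for z
  proof -
    obtain l where l: "(\<lambda>k. Phi lam p (x k) (w k) z) \<longlonglongrightarrow> l"
      using Phi[OF z] by (auto simp: convergent_def)
    obtain K1 where K1: "\<And>k. Phi lam p (x k) (w k) z \<le> K1"
      using convergent_imp_Bseq[OF Phi[OF z]] unfolding Bseq_def by (metis abs_le_D1 real_norm_def)
    have "norm (w k - z) \<le> sqrt (K1 / \<mu>)" for k
    proof -
      have "\<mu> * (norm (w k - z))\<^sup>2 \<le> K1"
        using K1[of k] lam by (simp add: Phi_def \<mu>_def) (smt (verit) mult_nonneg_nonneg zero_le_power2)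
      then show ?thesis using \<open>\<mu> > 0\<close> by (intro real_le_rsqrt) (simp add: field_simps)
    qed
    then obtain R where R: "\<And>k. norm (w k - z) \<le> R" by blast
    have "(\<lambda>k. lam * ((norm (x k - z))\<^sup>2 - (norm (w k - z))\<^sup>2)) \<longlonglongrightarrow> 0"
    proof (rule Lim_null_comparison)
      have "(\<lambda>k. lam * (norm (x k - w k) * (norm (x k - w k) + 2 * R))) \<longlonglongrightarrow> lam * (0 * (0 + 2 * R))"
        by (intro tendsto_intros xw)
      then show "(\<lambda>k. lam * (norm (x k - w k) * (norm (x k - w k) + 2 * R))) \<longlonglongrightarrow> 0" by simp
      have "\<bar>(norm (x k - z))\<^sup>2 - (norm (w k - z))\<^sup>2\<bar> \<le> norm (x k - w k) * (norm (x k - w k) + 2 * R)" for k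
      proof -
        have "\<bar>(norm (x k - z))\<^sup>2 - (norm (w k - z))\<^sup>2\<bar>
            = \<bar>norm (x k - z) - norm (w k - z)\<bar> * (norm (x k - z) + norm (w k - z))"
          by (simp add: power2_eq_square square_diff_square_factored abs_mult mult.commute)
        also have "\<dots> \<le> norm (x k - w k) * (norm (x k - w k) + 2 * R)"
          using norm_triangle_ineq3[of "x k - z" "w k - z"]
            norm_triangle_ineq[of "x k - w k" "w k - z"] R[of k]
          by (intro mult_mono) auto
        finally show ?thesis .
      qed
      then show "\<forall>\<^sub>F k in sequentially. norm (lam * ((norm (x k - z))\<^sup>2 - (norm (w k - z))\<^sup>2))
          \<le> lam * (norm (x k - w k) * (norm (x k - w k) + 2 * R))"
        using lam by (auto simp: abs_mult intro!: always_eventually mult_left_mono)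
    qed
    with l have "(\<lambda>k. sqrt ((Phi lam p (x k) (w k) z - lam * ((norm (x k - z))\<^sup>2 - (norm (w k - z))\<^sup>2))
        / (lam + \<mu>))) \<longlonglongrightarrow> sqrt ((l - 0) / (lam + \<mu>))"
      using lam \<open>\<mu> > 0\<close> by (intro tendsto_intros) auto
    moreover have "sqrt ((Phi lam p (x k) (w k) z - lam * ((norm (x k - z))\<^sup>2 - (norm (w k - z))\<^sup>2))
        / (lam + \<mu>)) = norm (w k - z)" for k
    proof -
      have "Phi lam p (x k) (w k) z - lam * ((norm (x k - z))\<^sup>2 - (norm (w k - z))\<^sup>2)
          = (lam + \<mu>) * (norm (w k - z))\<^sup>2"
        by (simp add: Phi_def \<mu>_def algebra_simps)
      then show ?thesis using lam \<open>\<mu> > 0\<close> by simp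
    qed
    ultimately have "(\<lambda>k. norm (w k - z)) \<longlonglongrightarrow> sqrt (l / (lam + \<mu>))" by simp
    moreover have "(\<lambda>k. norm (y k - z) - norm (w k - z)) \<longlonglongrightarrow> 0"
    proof (rule Lim_null_comparison[OF _ wy])
      show "\<forall>\<^sub>F k in sequentially. norm (norm (y k - z) - norm (w k - z)) \<le> norm (w k - y k)"
        using norm_triangle_ineq3[of "y k - z" "w k - z" for k]
        by (auto simp: norm_minus_commute intro!: always_eventually)
    qed
    ultimately have "(\<lambda>k. (norm (y k - z) - norm (w k - z)) + norm (w k - z)) \<longlonglongrightarrow> 0 + sqrt (l / (lam + \<mu>))"
      by (intro tendsto_add)
    then show ?thesis by (auto simp: convergent_def)
  qed
  \<comment> \<open>The elements of \<open>T (y k)\<close> from lemma \<open>residual_mem\<close>.\<close>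
  define v where "v k = (1 / \<gamma>) *\<^sub>R (lam *\<^sub>R x k + (1 - lam) *\<^sub>R w k - y k)
     + ((B (y k) + C (y k)) - (B (w k) + C (w k)))" for k
  have v_T: "v k \<in> T (y k)" for k
    unfolding v_def y_def by (rule residual_mem)
  have BC0: "(\<lambda>k. (B (y k) + C (y k)) - (B (w k) + C (w k))) \<longlonglongrightarrow> 0"
    by (rule Lim_null_comparison[OF _ tendsto_mult_right_zero[OF wy, of "K + 1 / \<beta>"]])
      (use BC_lipD in \<open>auto intro!: always_eventually simp: norm_minus_commute\<close>)
  have "(\<lambda>k. (1 / \<gamma>) *\<^sub>R (lam *\<^sub>R (x k - y k) + (1 - lam) *\<^sub>R (w k - y k))
      + ((B (y k) + C (y k)) - (B (w k) + C (w k))))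
      \<longlonglongrightarrow> (1 / \<gamma>) *\<^sub>R (lam *\<^sub>R 0 + (1 - lam) *\<^sub>R 0) + 0"
    by (intro tendsto_intros xy BC0 tendsto_norm_zero_cancel[OF wy])
  moreover have "lam *\<^sub>R (x k - y k) + (1 - lam) *\<^sub>R (w k - y k) = lam *\<^sub>R x k + (1 - lam) *\<^sub>R w k - y k" for k
    by (simp add: algebra_simps)
  ultimately have v0: "v \<longlonglongrightarrow> 0" by (simp add: v_def[abs_def])
  have fejer: "convergent (\<lambda>k. norm (y k - z))" if "0 \<in> T z" for z
    by (rule convergent_norm_diff_closure[OF conv_D]) (use D that in \<open>auto simp: zeros3_eq\<close>)
  have "0 \<in> T z0" using D by (auto simp: zeros3_eq)
  then obtain a where a: "0 \<in> T a" "weakly_converges y a"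
    using weakly_converges_to_zero_of_operator[OF T_max v_T v0 fejer] by blast
  have "weakly_converges x a"
    unfolding weakly_converges_def
  proof
    fix h
    have "(\<lambda>k. inner (x k - y k) h + inner (y k) h) \<longlonglongrightarrow> inner 0 h + inner a h"
      using a(2) unfolding weakly_converges_def
      by (intro tendsto_add tendsto_inner[OF xy tendsto_const]) blast
    then show "(\<lambda>k. inner (x k) h) \<longlonglongrightarrow> inner a h" by (simp add: inner_diff_left)
  qed
  with a(1) show ?thesis by (auto simp: zeros3_eq)
qed

end

section \<open>The random iterates\<close>

locale vrfbhf_run = splitting A B C Q Bo K L \<beta> lam \<gamma> + VRFBHF M A B C N Q Bo p \<gamma> lam x0 \<xi> coin x w y
  for A :: "'a::{real_inner,banach,second_countable_topology} \<Rightarrow> 'a set"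
    and B C Q Bo K L \<beta> lam \<gamma>
    and M :: "'w measure" and N p x0 \<xi> coin x w y +
  assumes p: "0 < p" "p \<le> 1"
begin

abbreviation \<F> :: "nat \<Rightarrow> 'w measure" where "\<F> k \<equiv> past M \<xi> coin x w k"
abbreviation \<H> :: "nat \<Rightarrow> 'w measure" where "\<H> k \<equiv> history M \<xi> w k"

lemma xi_measurable [measurable]: "\<xi> k \<in> measurable M (count_space UNIV)"
  using measurable_compose[OF xi_rv[of k] measurable_count_space[of "\<lambda>i. i"]] by simp

lemma vimage_algebra_Pow: "sets (vimage_algebra (space M) f N') \<subseteq> Pow (space M)"
  using sets.space_closed[of "vimage_algebra (space M) f N'"] by simp

lemma space_past [simp]: "space (\<F> k) = space M"
  by (simp add: past_def space_measure_of_conv)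

lemma space_history [simp]: "space (\<H> k) = space M"
  by (simp add: history_def space_measure_of_conv)

lemma sets_past: "sets (\<F> k) = sigma_sets (space M)
    ((\<Union>j\<in>{..<k}. sets (vimage_algebra (space M) (\<xi> j) (count_space UNIV))) \<union>
      (\<Union>j\<in>{..<k}. sets (vimage_algebra (space M) (coin j) (count_space UNIV))) \<union>
      (\<Union>j\<in>{..k}. sets (vimage_algebra (space M) (x j) borel)) \<union>
      (\<Union>j\<in>{..k}. sets (vimage_algebra (space M) (w j) borel)))"
  unfolding past_def by (intro sets_measure_of Un_least UN_least vimage_algebra_Pow)

lemma sets_history: "sets (\<H> k) = sigma_sets (space M)
     ((\<Union>j\<in>{..<k}. sets (vimage_algebra (space M) (\<xi> j) (count_space UNIV))) \<union>
      (\<Union>j\<in>{..k}. sets (vimage_algebra (space M) (w j) borel)))"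
  unfolding history_def by (intro sets_measure_of Un_least UN_least vimage_algebra_Pow)

lemma past_subalgebra: "subalgebra M (\<F> k)"
proof -
  have "sets (\<F> k) \<subseteq> sets M"
    unfolding sets_past
    by (intro sets.sigma_sets_subset Un_least UN_least sets_image_in_sets refl xi_measurable coin_rv x_rv w_rv)
  then show ?thesis by (simp add: subalgebra_def)
qed

lemma past_mono: "sets (\<F> k) \<subseteq> sets (\<F> (Suc k))"
  unfolding sets_past by (intro sigma_sets_mono' Un_mono UN_mono) auto

lemma history_mono: "sets (\<H> k) \<subseteq> sets (\<H> (Suc k))"
  unfolding sets_history by (intro sigma_sets_mono' Un_mono UN_mono) auto

lemma history_past: "sets (\<H> k) \<subseteq> sets (\<F> k)"
  unfolding sets_history sets_past by (intro sigma_sets_mono') auto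

lemma history_subalgebra: "subalgebra M (\<H> k)"
  using history_past past_subalgebra by (auto simp: subalgebra_def)

lemma x_past: "x k \<in> borel_measurable (\<F> k)"
  by (rule measurable_if_vimage_algebra_subset) (auto simp: sets_past intro!: sigma_sets.Basic)

lemma w_past: "w k \<in> borel_measurable (\<F> k)"
  by (rule measurable_if_vimage_algebra_subset) (auto simp: sets_past intro!: sigma_sets.Basic)

lemma w_history: "w k \<in> borel_measurable (\<H> k)"
  by (rule measurable_if_vimage_algebra_subset) (auto simp: sets_history intro!: sigma_sets.Basic)

lemma xi_history: "\<xi> k \<in> measurable (\<H> (Suc k)) (count_space UNIV)"
  by (rule measurable_if_vimage_algebra_subset) (auto simp: sets_history intro!: sigma_sets.Basic)

lemma backward_measurable:
  assumes "f \<in> borel_measurable G" "g \<in> borel_measurable G"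
  shows "(\<lambda>\<omega>. backward (f \<omega>) (g \<omega>)) \<in> borel_measurable G"
  by (rule borel_measurable_continuous_Pair[OF assms backward_continuous])

lemma forward_measurable:
  assumes i: "i \<in> set_pmf Q" and f: "f \<in> borel_measurable G" and g: "g \<in> borel_measurable G"
  shows "(\<lambda>\<omega>. forward i (f \<omega>) (g \<omega>)) \<in> borel_measurable G"
proof -
  have [measurable]: "Bo i \<in> borel_measurable borel"
    by (rule borel_measurable_continuous_onI[OF oracle_continuous[OF i]])
  note [measurable] = g backward_measurable[OF f g]
  show ?thesis unfolding forward_def by measurable
qed

lemma y_eq: "\<omega> \<in> space M \<Longrightarrow> y k \<omega> = backward (x k \<omega>) (w k \<omega>)"
  by (simp add: y_step backward_def)

lemma x_Suc: "\<omega> \<in> space M \<Longrightarrow> x (Suc k) \<omega> = forward (\<xi> k \<omega>) (x k \<omega>) (w k \<omega>)"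
  by (simp add: x_step y_eq forward_def)

lemma prob_xi: "prob {\<omega> \<in> space M. \<xi> k \<omega> = i} = pmf Q i"
proof -
  have "measure (distr M (count_space UNIV) (\<xi> k)) {i} = prob (\<xi> k -` {i} \<inter> space M)"
    by (rule measure_distr) auto
  then show ?thesis by (simp add: xi_distr measure_pmf_single vimage_def Int_def conj_commute)
qed

lemma prob_coin: "prob {\<omega> \<in> space M. coin k \<omega>} = p"
proof -
  have "measure (distr M (count_space UNIV) (coin k)) {True} = prob (coin k -` {True} \<inter> space M)"
    by (rule measure_distr) (auto intro: coin_rv)
  then show ?thesis using p by (simp add: coin_distr measure_pmf_single vimage_def Int_def conj_commute)
qed

lemma xi_in_support: "AE \<omega> in M. \<forall>k. \<xi> k \<omega> \<in> set_pmf Q"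
proof -
  have "AE \<omega> in M. \<xi> k \<omega> \<in> set_pmf Q" for k
  proof -
    have "AE i in distr M (count_space UNIV) (\<xi> k). i \<in> set_pmf Q"
      unfolding xi_distr by (rule AE_pmfI)
    then show ?thesis by (subst (asm) AE_distr_iff) auto
  qed
  then show ?thesis by (simp add: AE_all_countable)
qed

text \<open>After \<open>k\<close> steps from a deterministic start with finitely many possible draws, the iterates are
  essentially bounded (not uniformly in \<open>k\<close>). All integrability questions reduce to this.\<close>

lemma iterates_bounded: "\<exists>R. AE \<omega> in M. norm (x k \<omega>) \<le> R \<and> norm (w k \<omega>) \<le> R"
proof (induction k)
  case 0
  have "AE \<omega> in M. norm (x 0 \<omega>) \<le> norm x0 \<and> norm (w 0 \<omega>) \<le> norm x0"
    by (intro AE_I2) (simp add: x_0 w_0)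
  then show ?case by blast
next
  case (Suc k)
  then obtain R where R: "AE \<omega> in M. norm (x k \<omega>) \<le> R \<and> norm (w k \<omega>) \<le> R" by blast
  obtain R' where R': "\<And>i x w. i \<in> set_pmf Q \<Longrightarrow> norm x \<le> R \<Longrightarrow> norm w \<le> R \<Longrightarrow> norm (forward i x w) \<le> R'"
    by (rule forward_bounded[of R]) blast
  have "AE \<omega> in M. norm (x (Suc k) \<omega>) \<le> max R R' \<and> norm (w (Suc k) \<omega>) \<le> max R R'"
    using R xi_in_support AE_space
  proof eventually_elim
    case (elim \<omega>)
    then have "norm (x (Suc k) \<omega>) \<le> R'" using R' by (simp add: x_Suc)
    then show ?case using elim by (simp add: w_step le_max_iff_disj)
  qed
  then show ?case by blast
qed

lemma integrable_norm_sq: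
  assumes [measurable]: "f \<in> borel_measurable M" and "AE \<omega> in M. norm (f \<omega> :: 'a) \<le> R"
  shows "integrable M (\<lambda>\<omega>. (norm (f \<omega> - z))\<^sup>2)"
proof (rule integrable_const_bound)
  show "AE \<omega> in M. norm ((norm (f \<omega> - z))\<^sup>2) \<le> (R + norm z)\<^sup>2"
    using assms(2)
  proof eventually_elim
    case (elim \<omega>)
    then show ?case using norm_triangle_ineq4[of "f \<omega>" z] by (auto intro!: power_mono)
  qed
qed measurable

lemma x_sq_integrable: "integrable M (\<lambda>\<omega>. (norm (x k \<omega> - z))\<^sup>2)"
  using iterates_bounded[of k] integrable_norm_sq[OF x_rv] by (auto elim: AE_mp)

lemma w_sq_integrable: "integrable M (\<lambda>\<omega>. (norm (w k \<omega> - z))\<^sup>2)"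
  using iterates_bounded[of k] integrable_norm_sq[OF w_rv] by (auto elim: AE_mp)

lemma Phi_integrable: "integrable M (\<lambda>\<omega>. Phi lam p (x k \<omega>) (w k \<omega>) z)"
  unfolding Phi_def
  by (intro Bochner_Integration.integrable_add integrable_mult_right x_sq_integrable w_sq_integrable)

lemma forward_sq_integrable:
  assumes i: "i \<in> set_pmf Q"
  shows "integrable M (\<lambda>\<omega>. (norm (forward i (x k \<omega>) (w k \<omega>) - z))\<^sup>2)"
proof -
  obtain R where R: "AE \<omega> in M. norm (x k \<omega>) \<le> R \<and> norm (w k \<omega>) \<le> R"
    using iterates_bounded by blast
  obtain R' where R': "\<And>i x w. i \<in> set_pmf Q \<Longrightarrow> norm x \<le> R \<Longrightarrow> norm w \<le> R \<Longrightarrow> norm (forward i x w) \<le> R'"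
    by (rule forward_bounded[of R]) blast
  have "AE \<omega> in M. norm (forward i (x k \<omega>) (w k \<omega>)) \<le> R'"
    using R by eventually_elim (simp add: R' i)
  then show ?thesis by (rule integrable_norm_sq[OF forward_measurable[OF i x_rv w_rv]])
qed

lemma residual_sq_integrable: "integrable M (\<lambda>\<omega>. (norm (w k \<omega> - backward (x k \<omega>) (w k \<omega>)))\<^sup>2)"
proof -
  obtain R where R: "AE \<omega> in M. norm (x k \<omega>) \<le> R \<and> norm (w k \<omega>) \<le> R"
    using iterates_bounded by blast
  obtain R' where R': "\<And>x w. norm x \<le> R \<Longrightarrow> norm w \<le> R \<Longrightarrow> norm (backward x w) \<le> R'"
    by (rule backward_bounded[of R]) blast
  have "AE \<omega> in M. norm (w k \<omega> - backward (x k \<omega>) (w k \<omega>)) \<le> R + R'"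
    using R
  proof eventually_elim
    case (elim \<omega>)
    then show ?case
      using norm_triangle_ineq4[of "w k \<omega>" "backward (x k \<omega>) (w k \<omega>)"] R'[of "x k \<omega>" "w k \<omega>"] by linarith
  qed
  from integrable_norm_sq[OF borel_measurable_diff[OF w_rv backward_measurable[OF x_rv w_rv]] this, of 0]
  show ?thesis by simp
qed

text \<open>On an event \<open>E\<close> of the past, the coin is replaced by its mean \<open>p\<close> and then the draw by its mean over
  \<open>Q\<close>, both by independence; what is left is lemma \<open>descent\<close> under the integral. The coefficients fit
  because \<open>\<lambda> + \<mu> p = 1\<close> and \<open>\<mu> (1 - p) + (1 - \<lambda>) = \<mu>\<close> for \<open>\<mu> = (1 - \<lambda>) / p\<close>.\<close>

lemma expected_descent:
  assumes z: "z \<in> zeros3 A B C" and E: "E \<in> sets (\<F> k)"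
  shows "(\<integral>\<omega>. indicator E \<omega> * Phi lam p (x (Suc k) \<omega>) (w (Suc k) \<omega>) z \<partial>M)
    \<le> (\<integral>\<omega>. indicator E \<omega> * (Phi lam p (x k \<omega>) (w k \<omega>) z
          - \<epsilon> * (norm (w k \<omega> - backward (x k \<omega>) (w k \<omega>)))\<^sup>2) \<partial>M)"
proof -
  define \<mu> where "\<mu> = (1 - lam) / p"
  define X where "X i = {\<omega> \<in> space M. \<xi> k \<omega> = i}" for i
  define S where "S = {\<omega> \<in> space M. coin k \<omega>}"
  define h where "h i \<omega> = indicator E \<omega> * (norm (forward i (x k \<omega>) (w k \<omega>) - z))\<^sup>2" for i \<omega>
  define g where "g \<omega> = indicator E \<omega> * (norm (w k \<omega> - z))\<^sup>2" for \<omega>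
  \<comment> \<open>Almost surely the next squared distance on \<open>E\<close>, but with oracle values of probability zero left out,
    which makes it measurable with respect to past and draw.\<close>
  define H where "H \<omega> = (\<Sum>i\<in>set_pmf Q. indicator (X i) \<omega> * h i \<omega>)" for \<omega>
  let ?\<xi> = "vimage_algebra (space M) (\<xi> k) (count_space UNIV)"
  let ?coin = "vimage_algebra (space M) (coin k) (count_space UNIV)"
  define G where "G = sigma (space M) (sets (\<F> k) \<union> sets ?\<xi>)"
  have space_G: "space G = space M" by (simp add: G_def space_measure_of_conv)
  have sets_G: "sets G = sigma_sets (space M) (sets (\<F> k) \<union> sets ?\<xi>)"
    unfolding G_def
    by (intro sets_measure_of Un_least vimage_algebra_Pow) (use sets.space_closed[of "\<F> k"] in simp)
  have \<xi>_sub: "subalgebra M ?\<xi>"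
    using sets_image_in_sets[OF refl xi_measurable[of k]] by (simp add: subalgebra_def)
  have coin_sub: "subalgebra M ?coin"
    using sets_image_in_sets[OF refl coin_rv[of k]] by (simp add: subalgebra_def)
  have G_sub: "subalgebra M G"
    unfolding subalgebra_def space_G sets_G
    using past_subalgebra[of k] \<xi>_sub by (intro conjI refl sets.sigma_sets_subset) (auto simp: subalgebra_def)
  have past_G: "subalgebra G (\<F> k)"
    by (auto simp: subalgebra_def space_G sets_G)
  have E_M: "E \<in> sets M" using E past_subalgebra by (auto simp: subalgebra_def)
  have X_\<xi>: "X i \<in> sets ?\<xi>" for i
  proof -
    have "\<xi> k \<in> measurable ?\<xi> (count_space UNIV)" by (rule measurable_vimage_algebra1) simp
    from measurable_sets[OF this, of "{i}"] show ?thesis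
      by (simp add: X_def vimage_def Int_def conj_commute)
  qed
  have S_coin: "S \<in> sets ?coin"
  proof -
    have "coin k \<in> measurable ?coin (count_space UNIV)" by (rule measurable_vimage_algebra1) simp
    from measurable_sets[OF this, of "{True}"] show ?thesis
      by (simp add: S_def vimage_def Int_def conj_commute)
  qed
  have S_M: "S \<in> sets M" and X_M: "X i \<in> sets M" for i
    using S_coin coin_sub X_\<xi>[of i] \<xi>_sub by (auto simp: subalgebra_def)
  have ind_int: "integrable M (\<lambda>\<omega>. indicator V \<omega> * f \<omega>)" if "V \<in> sets M" "integrable M f" for V and f :: "'w \<Rightarrow> real"
    using integrable_mult_indicator[OF that] by simp
  have h_meas: "h i \<in> borel_measurable (\<F> k)" if i: "i \<in> set_pmf Q" for i
  proof -
    note [measurable] = forward_measurable[OF i x_past w_past, of k] E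
    show ?thesis unfolding h_def by measurable
  qed
  have h_int: "integrable M (h i)" if "i \<in> set_pmf Q" for i
    unfolding h_def by (rule ind_int[OF E_M forward_sq_integrable[OF that]])
  have g_meas: "g \<in> borel_measurable (\<F> k)"
  proof -
    note [measurable] = w_past[of k] E
    show ?thesis unfolding g_def by measurable
  qed
  have g_int: "integrable M g"
    unfolding g_def by (rule ind_int[OF E_M w_sq_integrable])
  have H_int: "integrable M H"
    unfolding H_def by (intro Bochner_Integration.integrable_sum ind_int X_M h_int)
  have H_meas: "H \<in> borel_measurable G"
  proof -
    have [measurable]: "X i \<in> sets G" for i
      unfolding sets_G using X_\<xi> by (intro sigma_sets.Basic) auto
    note [measurable] = measurable_from_subalg[OF past_G h_meas]
    show ?thesis unfolding H_def by measurable
  qed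
  have x_next: "AE \<omega> in M. indicator E \<omega> * (norm (x (Suc k) \<omega> - z))\<^sup>2 = H \<omega>"
    using xi_in_support AE_space
  proof eventually_elim
    case (elim \<omega>)
    have "H \<omega> = (\<Sum>i\<in>set_pmf Q. if i = \<xi> k \<omega> then h i \<omega> else 0)"
      unfolding H_def using elim by (intro sum.cong) (auto simp: X_def)
    also have "\<dots> = h (\<xi> k \<omega>) \<omega>" using elim Q_fin by simp
    finally show ?case using elim by (simp add: h_def x_Suc)
  qed
  have "AE \<omega> in M. indicator E \<omega> * Phi lam p (x (Suc k) \<omega>) (w (Suc k) \<omega>) z
      = lam * H \<omega> + \<mu> * (indicator S \<omega> * H \<omega> + (g \<omega> - indicator S \<omega> * g \<omega>))"
    using x_next AE_space
  proof eventually_elim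
    case (elim \<omega>)
    then show ?case
      by (cases "coin k \<omega>")
        (simp_all add: Phi_def \<mu>_def w_step S_def g_def distrib_left flip: elim(1))
  qed
  then have "(\<integral>\<omega>. indicator E \<omega> * Phi lam p (x (Suc k) \<omega>) (w (Suc k) \<omega>) z \<partial>M)
      = (\<integral>\<omega>. lam * H \<omega> + \<mu> * (indicator S \<omega> * H \<omega> + (g \<omega> - indicator S \<omega> * g \<omega>)) \<partial>M)"
    using ind_int[OF E_M Phi_integrable[of "Suc k" z]] H_int g_int ind_int[OF S_M H_int] ind_int[OF S_M g_int]
    by (intro integral_cong_AE) (auto intro!: borel_measurable_integrable)
  also have "\<dots> = lam * (\<integral>\<omega>. H \<omega> \<partial>M) + \<mu> * ((\<integral>\<omega>. indicator S \<omega> * H \<omega> \<partial>M)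
      + ((\<integral>\<omega>. g \<omega> \<partial>M) - (\<integral>\<omega>. indicator S \<omega> * g \<omega> \<partial>M)))"
    using H_int g_int ind_int[OF S_M H_int] ind_int[OF S_M g_int] by simp
  also have "(\<integral>\<omega>. indicator S \<omega> * H \<omega> \<partial>M) = p * (\<integral>\<omega>. H \<omega> \<partial>M)"
    using integral_indicator_indep[OF _ coin_sub G_sub S_coin H_meas H_int] coin_indep[of k] prob_coin[of k]
    by (simp add: sets_G S_def)
  also have "(\<integral>\<omega>. indicator S \<omega> * g \<omega> \<partial>M) = p * (\<integral>\<omega>. g \<omega> \<partial>M)"
    using integral_indicator_indep[OF _ coin_sub G_sub S_coin measurable_from_subalg[OF past_G g_meas] g_int]
      coin_indep[of k] prob_coin[of k] by (simp add: sets_G S_def)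
  also have "(\<integral>\<omega>. H \<omega> \<partial>M) = (\<Sum>i\<in>set_pmf Q. \<integral>\<omega>. indicator (X i) \<omega> * h i \<omega> \<partial>M)"
    unfolding H_def by (intro Bochner_Integration.integral_sum ind_int X_M h_int)
  also have "\<dots> = (\<Sum>i\<in>set_pmf Q. pmf Q i * (\<integral>\<omega>. h i \<omega> \<partial>M))"
  proof (intro sum.cong refl)
    fix i assume i: "i \<in> set_pmf Q"
    show "(\<integral>\<omega>. indicator (X i) \<omega> * h i \<omega> \<partial>M) = pmf Q i * (\<integral>\<omega>. h i \<omega> \<partial>M)"
      using integral_indicator_indep[OF xi_indep \<xi>_sub past_subalgebra X_\<xi> h_meas[OF i] h_int[OF i], of i]
        prob_xi[of k i] by (simp add: X_def)
  qed
  also have "\<dots> = (\<integral>\<omega>. (\<Sum>i\<in>set_pmf Q. pmf Q i * h i \<omega>) \<partial>M)"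
    using h_int by (simp add: Bochner_Integration.integral_sum)
  finally have step: "(\<integral>\<omega>. indicator E \<omega> * Phi lam p (x (Suc k) \<omega>) (w (Suc k) \<omega>) z \<partial>M)
      = (lam + \<mu> * p) * (\<integral>\<omega>. (\<Sum>i\<in>set_pmf Q. pmf Q i * h i \<omega>) \<partial>M) + \<mu> * (1 - p) * (\<integral>\<omega>. g \<omega> \<partial>M)"
    by (simp add: algebra_simps)
  have mean_descent: "(\<integral>\<omega>. (\<Sum>i\<in>set_pmf Q. pmf Q i * h i \<omega>) \<partial>M) \<le> (\<integral>\<omega>. indicator E \<omega> *
      (lam * (norm (x k \<omega> - z))\<^sup>2 + (1 - lam) * (norm (w k \<omega> - z))\<^sup>2
        - \<epsilon> * (norm (w k \<omega> - backward (x k \<omega>) (w k \<omega>)))\<^sup>2) \<partial>M)"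
  proof (rule integral_mono)
    show "integrable M (\<lambda>\<omega>. \<Sum>i\<in>set_pmf Q. pmf Q i * h i \<omega>)"
      by (intro Bochner_Integration.integrable_sum integrable_mult_right h_int)
    show "integrable M (\<lambda>\<omega>. indicator E \<omega> *
      (lam * (norm (x k \<omega> - z))\<^sup>2 + (1 - lam) * (norm (w k \<omega> - z))\<^sup>2
        - \<epsilon> * (norm (w k \<omega> - backward (x k \<omega>) (w k \<omega>)))\<^sup>2))"
      by (intro ind_int E_M Bochner_Integration.integrable_diff Bochner_Integration.integrable_add
          integrable_mult_right x_sq_integrable w_sq_integrable residual_sq_integrable)
    fix \<omega>
    have "(\<Sum>i\<in>set_pmf Q. pmf Q i * h i \<omega>)
        = indicator E \<omega> * (\<Sum>i\<in>set_pmf Q. pmf Q i * (norm (forward i (x k \<omega>) (w k \<omega>) - z))\<^sup>2)"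
      by (simp add: h_def sum_distrib_left mult.left_commute)
    also have "\<dots> \<le> indicator E \<omega> * (lam * (norm (x k \<omega> - z))\<^sup>2 + (1 - lam) * (norm (w k \<omega> - z))\<^sup>2
        - \<epsilon> * (norm (w k \<omega> - backward (x k \<omega>) (w k \<omega>)))\<^sup>2)"
      by (intro mult_left_mono descent[OF z]) auto
    finally show "(\<Sum>i\<in>set_pmf Q. pmf Q i * h i \<omega>) \<le> \<dots>" .
  qed
  have "lam + \<mu> * p = 1" using p by (simp add: \<mu>_def)
  from step[unfolded this] mean_descent have "(\<integral>\<omega>. indicator E \<omega> * Phi lam p (x (Suc k) \<omega>) (w (Suc k) \<omega>) z \<partial>M)
      \<le> (\<integral>\<omega>. indicator E \<omega> *
      (lam * (norm (x k \<omega> - z))\<^sup>2 + (1 - lam) * (norm (w k \<omega> - z))\<^sup>2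
        - \<epsilon> * (norm (w k \<omega> - backward (x k \<omega>) (w k \<omega>)))\<^sup>2) \<partial>M) + \<mu> * (1 - p) * (\<integral>\<omega>. g \<omega> \<partial>M)"
    by simp
  also have "\<dots> = (\<integral>\<omega>. indicator E \<omega> *
      (lam * (norm (x k \<omega> - z))\<^sup>2 + (1 - lam) * (norm (w k \<omega> - z))\<^sup>2
        - \<epsilon> * (norm (w k \<omega> - backward (x k \<omega>) (w k \<omega>)))\<^sup>2) + \<mu> * (1 - p) * g \<omega> \<partial>M)"
    by (subst Bochner_Integration.integral_add)
      (auto intro!: ind_int E_M Bochner_Integration.integrable_diff Bochner_Integration.integrable_add
        g_int x_sq_integrable w_sq_integrable residual_sq_integrable)
  also have "\<dots> = (\<integral>\<omega>. indicator E \<omega> * (Phi lam p (x k \<omega>) (w k \<omega>) z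
          - \<epsilon> * (norm (w k \<omega> - backward (x k \<omega>) (w k \<omega>)))\<^sup>2) \<partial>M)"
  proof (rule Bochner_Integration.integral_cong)
    have \<mu>: "\<mu> * (1 - p) + (1 - lam) = \<mu>" using p by (simp add: \<mu>_def field_simps)
    have Phi_eq: "Phi lam p (x k \<omega>) (w k \<omega>) z
        = lam * (norm (x k \<omega> - z))\<^sup>2 + (\<mu> * (1 - p) + (1 - lam)) * (norm (w k \<omega> - z))\<^sup>2" for \<omega>
      unfolding \<mu> by (simp add: Phi_def \<mu>_def)
    show "indicator E \<omega> *
      (lam * (norm (x k \<omega> - z))\<^sup>2 + (1 - lam) * (norm (w k \<omega> - z))\<^sup>2
        - \<epsilon> * (norm (w k \<omega> - backward (x k \<omega>) (w k \<omega>)))\<^sup>2) + \<mu> * (1 - p) * g \<omega>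
      = indicator E \<omega> * (Phi lam p (x k \<omega>) (w k \<omega>) z
          - \<epsilon> * (norm (w k \<omega> - backward (x k \<omega>) (w k \<omega>)))\<^sup>2)" for \<omega>
      unfolding Phi_eq g_def by (simp add: algebra_simps)
  qed simp
  finally show ?thesis .
qed

text \<open>The iterate \<open>x k\<close> is not listed among the generators of the history, but it can be recomputed from
  the draws and the points \<open>w\<close>. This is possible up to a null set only, because the oracle need not be
  measurable at values of probability zero.\<close>

lemma x_AE_history: "\<exists>g\<in>borel_measurable (\<H> k). AE \<omega> in M. x k \<omega> = g \<omega>"
proof (induction k)
  case 0
  have "AE \<omega> in M. x 0 \<omega> = x0" by (intro AE_I2) (rule x_0)
  then show ?case by (intro bexI[of _ "\<lambda>_. x0"]) auto
next
  case (Suc k)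
  then obtain g where g: "g \<in> borel_measurable (\<H> k)" and eq: "AE \<omega> in M. x k \<omega> = g \<omega>" by blast
  have sub: "subalgebra (\<H> (Suc k)) (\<H> k)"
    using history_mono by (simp add: subalgebra_def)
  define g' where "g' \<omega> = (\<Sum>i\<in>set_pmf Q. indicator {\<omega> \<in> space M. \<xi> k \<omega> = i} \<omega> *\<^sub>R forward i (g \<omega>) (w k \<omega>))" for \<omega>
  have "g' \<in> borel_measurable (\<H> (Suc k))"
    unfolding g'_def
  proof (intro borel_measurable_sum borel_measurable_scaleR borel_measurable_indicator forward_measurable)
    fix i
    show "{\<omega> \<in> space M. \<xi> k \<omega> = i} \<in> sets (\<H> (Suc k))"
      using measurable_sets[OF xi_history[of k], of "{i}"] by (simp add: vimage_def Int_def conj_commute)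
  qed (auto intro: measurable_from_subalg[OF sub] g w_history)
  moreover have "AE \<omega> in M. x (Suc k) \<omega> = g' \<omega>"
    using eq xi_in_support AE_space
  proof eventually_elim
    case (elim \<omega>)
    have "g' \<omega> = (\<Sum>i\<in>set_pmf Q. if i = \<xi> k \<omega> then forward i (g \<omega>) (w k \<omega>) else 0)"
      unfolding g'_def using elim by (intro sum.cong) auto
    also have "\<dots> = x (Suc k) \<omega>" using elim Q_fin by (simp add: x_Suc)
    finally show ?case by simp
  qed
  ultimately show ?case by blast
qed

lemma cond_exp_descent:
  assumes z: "z \<in> zeros3 A B C"
  shows "AE \<omega> in M. real_cond_exp M (\<H> k) (\<lambda>\<omega>. Phi lam p (x (Suc k) \<omega>) (w (Suc k) \<omega>) z) \<omega>
    \<le> Phi lam p (x k \<omega>) (w k \<omega>) z"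
proof -
  obtain g where g: "g \<in> borel_measurable (\<H> k)" and eq: "AE \<omega> in M. x k \<omega> = g \<omega>"
    using x_AE_history by blast
  note [measurable] = g w_history[of k]
  show ?thesis
  proof (rule real_cond_exp_le[OF history_subalgebra Phi_integrable Phi_integrable])
    show "(\<lambda>\<omega>. Phi lam p (g \<omega>) (w k \<omega>) z) \<in> borel_measurable (\<H> k)"
      unfolding Phi_def by measurable
    show "AE \<omega> in M. Phi lam p (x k \<omega>) (w k \<omega>) z = Phi lam p (g \<omega>) (w k \<omega>) z"
      using eq by eventually_elim simp
    fix E assume "E \<in> sets (\<H> k)"
    then have E: "E \<in> sets (\<F> k)" using history_past by blast
    then have E_M: "E \<in> sets M" using past_subalgebra by (auto simp: subalgebra_def)
    have ind_int: "integrable M (\<lambda>\<omega>. indicator E \<omega> * f \<omega>)" if "integrable M f" for f :: "'w \<Rightarrow> real"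
      using integrable_mult_indicator[OF E_M that] by simp
    have "(\<integral>\<omega>. indicator E \<omega> * Phi lam p (x (Suc k) \<omega>) (w (Suc k) \<omega>) z \<partial>M)
      \<le> (\<integral>\<omega>. indicator E \<omega> * (Phi lam p (x k \<omega>) (w k \<omega>) z
          - \<epsilon> * (norm (w k \<omega> - backward (x k \<omega>) (w k \<omega>)))\<^sup>2) \<partial>M)"
      by (rule expected_descent[OF z E])
    also have "\<dots> \<le> (\<integral>\<omega>. indicator E \<omega> * Phi lam p (x k \<omega>) (w k \<omega>) z \<partial>M)"
      using eps_pos
      by (intro integral_mono ind_int Bochner_Integration.integrable_diff Phi_integrable
          integrable_mult_right residual_sq_integrable mult_left_mono) auto
    finally show "(\<integral>\<omega>. indicator E \<omega> * Phi lam p (x (Suc k) \<omega>) (w (Suc k) \<omega>) z \<partial>M)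
      \<le> (\<integral>\<omega>. indicator E \<omega> * Phi lam p (x k \<omega>) (w k \<omega>) z \<partial>M)" .
  qed
qed

lemma Phi_convergent:
  assumes z: "z \<in> zeros3 A B C"
  shows "AE \<omega> in M. convergent (\<lambda>k. Phi lam p (x k \<omega>) (w k \<omega>) z)
    \<and> summable (\<lambda>k. \<epsilon> * (norm (w k \<omega> - backward (x k \<omega>) (w k \<omega>)))\<^sup>2)"
proof (rule almost_supermartingale_convergent[where F = \<F>])
  fix k
  note [measurable] = x_past[of k] w_past[of k] backward_measurable[OF x_past w_past, of k]
  show "(\<lambda>\<omega>. Phi lam p (x k \<omega>) (w k \<omega>) z) \<in> borel_measurable (\<F> k)"
    unfolding Phi_def by measurable
  show "(\<lambda>\<omega>. \<epsilon> * (norm (w k \<omega> - backward (x k \<omega>) (w k \<omega>)))\<^sup>2) \<in> borel_measurable (\<F> k)"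
    by measurable
  show "0 \<le> Phi lam p (x k \<omega>) (w k \<omega>) z" for \<omega>
    using lam p by (simp add: Phi_def)
  show "0 \<le> \<epsilon> * (norm (w k \<omega> - backward (x k \<omega>) (w k \<omega>)))\<^sup>2" for \<omega>
    using eps_pos by simp
qed (intro past_subalgebra past_mono Phi_integrable integrable_mult_right residual_sq_integrable
      expected_descent[OF z], assumption?)+

lemma AE_weakly_convergent:
  assumes "z0 \<in> zeros3 A B C"
  shows "AE \<omega> in M. \<exists>c\<in>zeros3 A B C. weakly_converges (\<lambda>k. x k \<omega>) c"
proof -
  obtain D where D: "countable D" "D \<subseteq> zeros3 A B C" "zeros3 A B C \<subseteq> closure D"
    by (rule separable[of "zeros3 A B C"])
  have "D \<noteq> {}" using assms D(3) by auto
  then obtain d where d: "d \<in> D" by blast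
  have "AE \<omega> in M. \<forall>z\<in>D. convergent (\<lambda>k. Phi lam p (x k \<omega>) (w k \<omega>) z)
    \<and> summable (\<lambda>k. \<epsilon> * (norm (w k \<omega> - backward (x k \<omega>) (w k \<omega>)))\<^sup>2)"
    using D Phi_convergent by (subst AE_ball_countable) auto
  with xi_in_support AE_space show ?thesis
  proof eventually_elim
    case (elim \<omega>)
    show ?case
    proof (rule pathwise_weak_convergence[where D = D and p = p and w = "\<lambda>k. w k \<omega>"])
      show "\<exists>i\<in>set_pmf Q. x (Suc k) \<omega> = forward i (x k \<omega>) (w k \<omega>)" for k
        using elim x_Suc by blast
      show "w (Suc k) \<omega> = x (Suc k) \<omega> \<or> w (Suc k) \<omega> = w k \<omega>" for k
        using elim by (simp add: w_step)
    qed (use elim d D p in auto)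
  qed
qed

text \<open>On the exceptional null set the limit is given the value \<open>z0\<close>. Measurability is checked weakly, where
  the limit is an ordinary limit of real random variables.\<close>

lemma weak_limit_random_variable:
  assumes z0: "z0 \<in> zeros3 A B C"
  shows "\<exists>xinf\<in>borel_measurable M. (\<forall>\<omega>\<in>space M. xinf \<omega> \<in> zeros3 A B C) \<and>
    (AE \<omega> in M. weakly_converges (\<lambda>k. x k \<omega>) (xinf \<omega>))"
proof -
  obtain Z0 where Z0: "Z0 \<in> null_sets M"
      and conv: "\<And>\<omega>. \<omega> \<in> space M - Z0 \<Longrightarrow> \<exists>c\<in>zeros3 A B C. weakly_converges (\<lambda>k. x k \<omega>) c"
    using AE_weakly_convergent[OF z0] by (auto elim!: AE_E3)
  then have [measurable]: "Z0 \<in> sets M" by auto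
  define xinf where "xinf \<omega> = (if \<omega> \<in> space M - Z0
      then SOME c. c \<in> zeros3 A B C \<and> weakly_converges (\<lambda>k. x k \<omega>) c else z0)" for \<omega>
  have good: "xinf \<omega> \<in> zeros3 A B C" "weakly_converges (\<lambda>k. x k \<omega>) (xinf \<omega>)"
    if "\<omega> \<in> space M - Z0" for \<omega>
    using someI_ex[of "\<lambda>c. c \<in> zeros3 A B C \<and> weakly_converges (\<lambda>k. x k \<omega>) c"] conv[OF that] that
    by (auto simp: xinf_def)
  have "xinf \<in> borel_measurable M"
  proof (rule borel_measurable_weakly)
    fix h
    note [measurable] = x_rv
    show "(\<lambda>\<omega>. inner (xinf \<omega>) h) \<in> borel_measurable M"
    proof (rule borel_measurable_LIMSEQ_real)
      show "(\<lambda>\<omega>. if \<omega> \<in> Z0 then inner z0 h else inner (x k \<omega>) h) \<in> borel_measurable M" for k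
        by measurable
      show "(\<lambda>k. if \<omega> \<in> Z0 then inner z0 h else inner (x k \<omega>) h) \<longlonglongrightarrow> inner (xinf \<omega>) h"
        if "\<omega> \<in> space M" for \<omega>
        using good(2)[of \<omega>] that by (auto simp: weakly_converges_def xinf_def)
    qed
  qed
  moreover have "xinf \<omega> \<in> zeros3 A B C" for \<omega>
    using good(1)[of \<omega>] z0 by (cases "\<omega> \<in> space M - Z0") (auto simp: xinf_def)
  moreover have "AE \<omega> in M. weakly_converges (\<lambda>k. x k \<omega>) (xinf \<omega>)"
    using AE_not_in[OF Z0] AE_space by eventually_elim (auto intro: good)
  ultimately show ?thesis by blast
qed

end

section \<open>Almost sure weak convergence\<close>

theorem theorem2p1:
  fixes A :: "'a::{real_inner,banach,second_countable_topology} \<Rightarrow> 'a set"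
    and B C :: "'a \<Rightarrow> 'a"
    and N :: nat
    and Bi :: "nat \<Rightarrow> 'a \<Rightarrow> 'a"
    and Li :: "nat \<Rightarrow> real"
    and Q :: "nat pmf"
    and Bo :: "nat \<Rightarrow> 'a \<Rightarrow> 'a"
    and L \<beta> lam p \<gamma> :: real
    and M :: "'w measure"
    and x0 :: 'a
    and \<xi> :: "nat \<Rightarrow> 'w \<Rightarrow> nat"
    and coin :: "nat \<Rightarrow> 'w \<Rightarrow> bool"
    and x w y :: "nat \<Rightarrow> 'w \<Rightarrow> 'a"
  assumes A_max: "maximally_monotone A"
    and B_sum: "\<And>u. B u = (\<Sum>i=1..N. Bi i u)"
    and B_mono: "monotone_operator (\<lambda>u. {B u})"
    and Bi_lip: "\<And>i. i \<in> {1..N} \<Longrightarrow> (Li i)-lipschitz_on UNIV (Bi i)"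
    and Q_supp: "set_pmf Q \<subseteq> {1..N}"
    and unbiased: "\<And>u. B u = measure_pmf.expectation Q (\<lambda>i. Bo i u)"
    and L_pos: "L > 0"
    and mean_lip: "\<And>u v. measure_pmf.expectation Q (\<lambda>i. (norm (Bo i u - Bo i v))\<^sup>2)
                     \<le> L\<^sup>2 * (norm (u - v))\<^sup>2"
    and beta_pos: "\<beta> > 0"
    and C_coco: "cocoercive \<beta> C"
    and Z_ne: "zeros3 A B C \<noteq> {}"
    and lam: "lam \<in> {0..<1}"
    and p: "p \<in> {0<..1}"
    and gamma: "\<gamma> \<in> {0 <..< 4 * \<beta> * (1 - lam) / (1 + sqrt (1 + 16 * \<beta>\<^sup>2 * L\<^sup>2 * (1 - lam)))}"
    and run: "VRFBHF M A B C N Q Bo p \<gamma> lam x0 \<xi> coin x w y"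
  shows "(\<forall>xs\<in>zeros3 A B C. \<forall>k.
            integrable M (\<lambda>\<omega>. Phi lam p (x (Suc k) \<omega>) (w (Suc k) \<omega>) xs) \<and>
            (AE \<omega> in M.
               real_cond_exp M (history M \<xi> w k)
                 (\<lambda>\<omega>. Phi lam p (x (Suc k) \<omega>) (w (Suc k) \<omega>) xs) \<omega>
               \<le> Phi lam p (x k \<omega>) (w k \<omega>) xs)) \<and>
         (\<exists>xinf\<in>borel_measurable M.
            (\<forall>\<omega>\<in>space M. xinf \<omega> \<in> zeros3 A B C) \<and>
            (AE \<omega> in M. weakly_converges (\<lambda>k. x k \<omega>) (xinf \<omega>)))"
proof -
  obtain K where K: "K-lipschitz_on UNIV B"
  proof
    show "(\<Sum>i=1..N. Li i)-lipschitz_on UNIV B"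
    proof (rule lipschitz_onI)
      fix u v
      have "norm (B u - B v) = norm (\<Sum>i=1..N. Bi i u - Bi i v)"
        by (simp add: B_sum sum_subtractf)
      also have "\<dots> \<le> (\<Sum>i=1..N. norm (Bi i u - Bi i v))"
        by (rule norm_sum)
      also have "\<dots> \<le> (\<Sum>i=1..N. Li i * norm (u - v))"
        using Bi_lip by (intro sum_mono) (auto simp: lipschitz_on_def dist_norm)
      finally show "dist (B u) (B v) \<le> (\<Sum>i=1..N. Li i) * dist u v"
        by (simp add: dist_norm sum_distrib_right)
    qed (use Bi_lip lipschitz_on_nonneg in \<open>blast intro: sum_nonneg\<close>)
  qed
  interpret VRFBHF M A B C N Q Bo p \<gamma> lam x0 \<xi> coin x w y
    by (rule run)
  interpret vrfbhf_run A B C Q Bo K L \<beta> lam \<gamma> M N p x0 \<xi> coin x w y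
  proof unfold_locales
    show "0 \<le> inner (B u - B v) (u - v)" for u v
      using B_mono by (simp add: monotone_operator_def)
    show "finite (set_pmf Q)" using Q_supp finite_subset by blast
    show "\<gamma> / (2 * \<beta>) + \<gamma>\<^sup>2 * L\<^sup>2 < 1 - lam"
      using step_size_gap[OF beta_pos L_pos _ gamma] lam by simp
  qed (use A_max K unbiased mean_lip beta_pos C_coco lam p gamma in auto)
  obtain z0 where "z0 \<in> zeros3 A B C" using Z_ne by blast
  then show ?thesis
    using Phi_integrable cond_exp_descent weak_limit_random_variable by blast
qed

end
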